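(* Let $A$ be an abelian group and $f:Z_{\mathrm{MM}}(d,r)\to A$ a group homomorphism. Then $f$ is weakly valuative if and only if it is strongly valuative.
   Context: $[d]=\{1,\dots,d\}$. A megamatroid on $[d]$ is a function $\mathrm{rk}:2^{[d]}\to\mathbb Z\cup\{\infty\}$ with $\mathrm{rk}(\emptyset)=0$, $\mathrm{rk}([d])\in\mathbb Z$, and such that whenever $\mathrm{rk}(A),\mathrm{rk}(B)\in\mathbb Z$ we have $\mathrm{rk}(A\cup B),\mathrm{rk}(A\cap B)\in\mathbb Z$ and $\mathrm{rk}(A\cup B)+\mathrm{rk}(A\cap B)\le\mathrm{rk}(A)+\mathrm{rk}(B)$; its rank is $\mathrm{rk}([d])$. Its base polyhedron is $Q(\mathrm{rk})=\{y\in\mathbb R^d:\sum_iy_i=\mathrm{rk}([d]),\ \sum_{i\in A}y_i\le\mathrm{rk}(A)\ \forall A\}$; a megamatroid polyhedron is a polyhedron of this form, and each determines a unique megamatroid $\mathrm{rk}$ with $Q(\mathrm{rk})$ equal to it. $Z_{\mathrm{MM}}(d,r)$ is the free abelian group with basis symbols $\langle\mathrm{rk}\rangle$, $\mathrm{rk}$ a megamatroid on $[d]$ of rank $r$. $P_{\mathrm{MM}}(d,r)$ is the $\mathbb Z$-module of functions $\mathbb R^d\to\mathbb Z$ generated by the indicator functions $[Q(\mathrm{rk})]$, and $\Psi_{\mathrm{MM}}:Z_{\mathrm{MM}}(d,r)\to P_{\mathrm{MM}}(d,r)$ is $\langle\mathrm{rk}\rangle\mapsto[Q(\mathrm{rk})]$.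 A megamatroid polyhedron decomposition is an equality $\Pi=\Pi_1\cup\dots\cup\Pi_k$ of megamatroid polyhedra such that for $i\ne j$, $\Pi_i\cap\Pi_j$ is empty or contained in a proper face of $\Pi_i$ and of $\Pi_j$. For $I\subseteq\{1,\dots,k\}$ let $\Pi_I=\bigcap_{i\in I}\Pi_i$ ($\Pi_\emptyset=\Pi$), $m_I=\langle\mathrm{rk}^I\rangle$ where $Q(\mathrm{rk}^I)=\Pi_I$ if $\Pi_I\ne\emptyset$, and $m_I=0$ otherwise; set $m_{\mathrm{val}}(\Pi;\Pi_1,\dots,\Pi_k)=\sum_I(-1)^{|I|}m_I\in Z_{\mathrm{MM}}(d,r)$. $f$ is weakly valuative if $f(m_{\mathrm{val}}(\Pi;\Pi_1,\dots,\Pi_k))=0$ for every megamatroid polyhedron decomposition (of polyhedra in $\{\sum y_i=r\}$), and strongly valuative if $f=\hat f\circ\Psi_{\mathrm{MM}}$ for some homomorphism $\hat f:P_{\mathrm{MM}}(d,r)\to A$.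
   Formalization: Weak valuativity is required only for decompositions whose nonempty intersections Π_I are all megamatroid polyhedra, so that m_val is defined; this can fail for decompositions as literally defined, e.g. for d=5. Also d≥1 is assumed. *)

theory Defs
  imports "HOL-Analysis.Analysis" "HOL-Algebra.Free_Abelian_Groups"
begin

text \<open>
  The ground set is the universe of a finite type \<open>'n\<close> with \<open>d = CARD('n)\<close> elements, and
  \<open>real ^ 'n\<close> is the ambient space.  Rank functions take values in \<open>ereal\<close>, restricted to
  integers and \<open>\<infinity>\<close>.
\<close>

definition is_integer :: "ereal \<Rightarrow> bool" where
  "is_integer x \<longleftrightarrow> (\<exists>z::int. x = ereal (of_int z))"

definition megamatroid :: "('n::finite set \<Rightarrow> ereal) \<Rightarrow> bool" where
  "megamatroid rk \<longleftrightarrow>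
     (\<forall>A. is_integer (rk A) \<or> rk A = \<infinity>) \<and>
     rk {} = 0 \<and>
     is_integer (rk UNIV) \<and>
     (\<forall>A B. is_integer (rk A) \<and> is_integer (rk B) \<longrightarrow>
        is_integer (rk (A \<union> B)) \<and> is_integer (rk (A \<inter> B)) \<and>
        rk (A \<union> B) + rk (A \<inter> B) \<le> rk A + rk B)"

definition megamatroids :: "int \<Rightarrow> ('n::finite set \<Rightarrow> ereal) set" where
  "megamatroids r = {rk. megamatroid rk \<and> rk UNIV = ereal (of_int r)}"

definition base_polyhedron :: "('n::finite set \<Rightarrow> ereal) \<Rightarrow> (real ^ 'n) set" where
  "base_polyhedron rk =
     {y. ereal (\<Sum>i\<in>UNIV. y $ i) = rk UNIV \<and> (\<forall>A. ereal (\<Sum>i\<in>A. y $ i) \<le> rk A)}"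

definition megamatroid_polyhedron :: "(real ^ 'n::finite) set \<Rightarrow> bool" where
  "megamatroid_polyhedron P \<longleftrightarrow> (\<exists>rk. megamatroid rk \<and> base_polyhedron rk = P)"

text \<open>Well defined on megamatroid polyhedra: \<open>rk A\<close> is the supremum of \<open>\<Sum>i\<in>A. y $ i\<close> over the base polyhedron.\<close>

definition megamatroid_of :: "(real ^ 'n::finite) set \<Rightarrow> ('n set \<Rightarrow> ereal)" where
  "megamatroid_of P = (THE rk. megamatroid rk \<and> base_polyhedron rk = P)"

definition Z_MM :: "int \<Rightarrow> (('n::finite set \<Rightarrow> ereal) \<Rightarrow>\<^sub>0 int) monoid" where
  "Z_MM r = free_Abelian_group (megamatroids r)"

definition int_functions :: "('b \<Rightarrow> int) monoid" where
  "int_functions = \<lparr>carrier = UNIV, mult = (\<lambda>g h x. g x + h x), one = (\<lambda>x. 0)\<rparr>"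

definition P_MM :: "int \<Rightarrow> ((real ^ 'n::finite) \<Rightarrow> int) monoid" where
  "P_MM r = int_functions
     \<lparr>carrier := generate int_functions
        ((\<lambda>rk. indicator (base_polyhedron rk)) ` megamatroids r)\<rparr>"

definition Psi_MM :: "(('n::finite set \<Rightarrow> ereal) \<Rightarrow>\<^sub>0 int) \<Rightarrow> (real ^ 'n \<Rightarrow> int)" where
  "Psi_MM c = (\<lambda>y. \<Sum>rk\<in>Poly_Mapping.keys c.
     Poly_Mapping.lookup c rk * indicator (base_polyhedron rk) y)"

definition megamatroid_decomposition ::
    "(real ^ 'n::finite) set \<Rightarrow> nat \<Rightarrow> (nat \<Rightarrow> (real ^ 'n) set) \<Rightarrow> bool" where
  "megamatroid_decomposition P k Q \<longleftrightarrow>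
     megamatroid_polyhedron P \<and>
     (\<forall>i\<in>{1..k}. megamatroid_polyhedron (Q i)) \<and>
     P = (\<Union>i\<in>{1..k}. Q i) \<and>
     (\<forall>i\<in>{1..k}. \<forall>j\<in>{1..k}. i \<noteq> j \<longrightarrow>
        Q i \<inter> Q j = {} \<or>
        (\<exists>F. F face_of Q i \<and> F \<noteq> Q i \<and> Q i \<inter> Q j \<subseteq> F) \<and>
        (\<exists>F. F face_of Q j \<and> F \<noteq> Q j \<and> Q i \<inter> Q j \<subseteq> F))"

definition cell :: "(real ^ 'n::finite) set \<Rightarrow> (nat \<Rightarrow> (real ^ 'n) set) \<Rightarrow> nat set \<Rightarrow> (real ^ 'n) set" where
  "cell P Q I = (if I = {} then P else (\<Inter>i\<in>I. Q i))"

text \<open>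
  The elements \<open>m_I\<close> only make sense if every nonempty intersection of pieces is again a
  megamatroid polyhedron.  This does not follow from \<^const>\<open>megamatroid_decomposition\<close>, which does
  not require the pieces to meet face to face: for \<open>d = 5\<close>, cut \<open>{y. y\<^sub>1 + \<dots> + y\<^sub>5 = 0}\<close> into the
  two halves \<open>y\<^sub>5 \<ge> 0\<close> and \<open>y\<^sub>5 \<le> 0\<close>, the first one further along \<open>y\<^sub>1 + y\<^sub>2 = 0\<close> and the second one
  along \<open>y\<^sub>1 + y\<^sub>3 = 0\<close>.
\<close>

definition cells_megamatroidal ::
    "(real ^ 'n::finite) set \<Rightarrow> nat \<Rightarrow> (nat \<Rightarrow> (real ^ 'n) set) \<Rightarrow> bool" where
  "cells_megamatroidal P k Q \<longleftrightarrow>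
     (\<forall>I\<subseteq>{1..k}. cell P Q I \<noteq> {} \<longrightarrow> megamatroid_polyhedron (cell P Q I))"

definition m_val ::
    "(real ^ 'n::finite) set \<Rightarrow> nat \<Rightarrow> (nat \<Rightarrow> (real ^ 'n) set) \<Rightarrow> (('n set \<Rightarrow> ereal) \<Rightarrow>\<^sub>0 int)" where
  "m_val P k Q = (\<Sum>I\<in>Pow {1..k}. frag_cmul ((-1) ^ card I)
     (if cell P Q I = {} then 0 else frag_of (megamatroid_of (cell P Q I))))"

definition weakly_valuative ::
    "int \<Rightarrow> ('a, 'b) monoid_scheme \<Rightarrow> ((('n::finite set \<Rightarrow> ereal) \<Rightarrow>\<^sub>0 int) \<Rightarrow> 'a) \<Rightarrow> bool" where
  "weakly_valuative r A f \<longleftrightarrow>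
     (\<forall>P k Q. megamatroid_decomposition P k Q \<and> cells_megamatroidal P k Q \<and>
        P \<subseteq> {y. (\<Sum>i\<in>UNIV. y $ i) = of_int r} \<longrightarrow>
        f (m_val P k Q) = \<one>\<^bsub>A\<^esub>)"

definition strongly_valuative ::
    "int \<Rightarrow> ('a, 'b) monoid_scheme \<Rightarrow> ((('n::finite set \<Rightarrow> ereal) \<Rightarrow>\<^sub>0 int) \<Rightarrow> 'a) \<Rightarrow> bool" where
  "strongly_valuative r A f \<longleftrightarrow>
     (\<exists>g \<in> hom (P_MM r) A. \<forall>c \<in> carrier (Z_MM r). f c = g (Psi_MM c))"

end

theory Submission
  imports Defs
begin

text \<open>
  For a direction \<open>u = e\<^sub>i - e\<^sub>j\<close> and a megamatroid polyhedron \<open>P\<close>, the ray sums \<open>P + \<real>\<^sub>\<ge>\<^sub>0 u\<close>,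
  \<open>P - \<real>\<^sub>\<ge>\<^sub>0 u\<close> and \<open>P + \<real> u\<close> are again megamatroid polyhedra.  Both \<open>P + \<real>\<^sub>\<ge>\<^sub>0 u\<close> and \<open>P + \<real> u\<close> are
  decomposed, into \<open>P\<close> resp. \<open>P - \<real>\<^sub>\<ge>\<^sub>0 u\<close> and the pieces \<open>F + \<real>\<^sub>\<ge>\<^sub>0 u\<close> with \<open>F\<close> a maximal face
  of \<open>P\<close> through which \<open>u\<close> leaves \<open>P\<close>.  Subtracting the two relations \<open>m_val\<close> shows that
  \<open>\<langle>P\<rangle> + \<langle>P + \<real> u\<rangle> - \<langle>P + \<real>\<^sub>\<ge>\<^sub>0 u\<rangle> - \<langle>P - \<real>\<^sub>\<ge>\<^sub>0 u\<rangle>\<close> is killed by every weakly valuative map.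

  The map \<open>\<langle>P\<rangle> \<mapsto> \<langle>P + \<real>\<^sub>\<ge>\<^sub>0 u\<rangle>\<close> preserves the kernel of \<open>\<Psi>\<close>, because on each line parallel
  to \<open>u\<close> it is a statement about closed intervals.  Applying the relation for all pairs \<open>i, j\<close>
  reduces an element of the kernel of \<open>\<Psi>\<close> to elements of that kernel for which the sets of finite
  rank of all the megamatroids involved lie in a single chain, and such an element vanishes
  because the indicator functions of distinct orthants are linearly independent.
\<close>

section \<open>Base polyhedra and ray sums\<close>

definition wt :: "'n::finite set \<Rightarrow> real ^ 'n \<Rightarrow> real" where
  "wt A y = (\<Sum>i\<in>A. y $ i)"

lemma wt_empty [simp]: "wt {} y = 0"
  by (simp add: wt_def)

lemma wt_add: "wt A (x + y) = wt A x + wt A y"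
  by (simp add: wt_def sum.distrib)

lemma wt_diff: "wt A (x - y) = wt A x - wt A y"
  by (simp add: wt_def sum_subtractf)

lemma wt_scaleR: "wt A (t *\<^sub>R y) = t * wt A y"
  by (simp add: wt_def sum_distrib_left)

lemma wt_modular: "wt (A \<union> B) y + wt (A \<inter> B) y = wt A y + wt B y"
  unfolding wt_def by (rule sum.union_inter) auto

lemma wt_conv_inner: "wt A y = (\<chi> i. of_bool (i \<in> A)) \<bullet> y"
  by (simp add: wt_def inner_vec_def if_distrib sum.If_cases of_bool_def
      if_distribR cong: if_cong)

definition dir :: "'n::finite \<Rightarrow> 'n \<Rightarrow> real ^ 'n" where
  "dir i j = axis i 1 - axis j 1"

lemma wt_dir: "wt A (dir i j) = of_bool (i \<in> A) - of_bool (j \<in> A)"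
  by (simp add: wt_def dir_def axis_def sum_subtractf)

lemma wt_dir_shift: "wt A (y + t *\<^sub>R dir i j) = wt A y + t * (of_bool (i \<in> A) - of_bool (j \<in> A))"
  by (simp add: wt_add wt_scaleR wt_dir)

definition finite_ranks :: "('n set \<Rightarrow> ereal) \<Rightarrow> 'n set set" where
  "finite_ranks rk = {A. rk A \<noteq> \<infinity>}"

text \<open>Real-valued ranks avoid \<open>ereal\<close> arithmetic. They are meaningful only on
  \<open>finite_ranks rk\<close>, since \<open>real_of_ereal\<close> sends \<infinity> to 0.\<close>

definition rv :: "('n set \<Rightarrow> ereal) \<Rightarrow> 'n set \<Rightarrow> real" where
  "rv rk A = real_of_ereal (rk A)"

lemma is_integer_not_infty: "is_integer x \<Longrightarrow> x \<noteq> \<infinity>"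
  by (auto simp: is_integer_def)

lemma megamatroid_is_integer_iff:
  assumes "megamatroid rk"
  shows "is_integer (rk A) \<longleftrightarrow> A \<in> finite_ranks rk"
  using assms by (auto simp: megamatroid_def finite_ranks_def dest: is_integer_not_infty)

lemma megamatroid_rv:
  assumes "megamatroid rk" "A \<in> finite_ranks rk"
  shows "rk A = ereal (rv rk A)"
  using assms by (auto simp: megamatroid_is_integer_iff[symmetric] is_integer_def rv_def)

lemma megamatroid_rv_empty: "megamatroid rk \<Longrightarrow> rv rk {} = 0"
  by (simp add: megamatroid_def rv_def)

lemma megamatroid_empty_finite: "megamatroid rk \<Longrightarrow> {} \<in> finite_ranks rk"
  by (simp add: megamatroid_def finite_ranks_def)

lemma megamatroid_UNIV_finite: "megamatroid rk \<Longrightarrow> UNIV \<in> finite_ranks rk"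
  by (simp add: megamatroid_is_integer_iff[symmetric]) (simp add: megamatroid_def)

lemma megamatroid_lattice:
  assumes "megamatroid rk" "A \<in> finite_ranks rk" "B \<in> finite_ranks rk"
  shows "A \<union> B \<in> finite_ranks rk" "A \<inter> B \<in> finite_ranks rk"
  using assms by (auto simp: megamatroid_is_integer_iff[symmetric]) (auto simp: megamatroid_def)

lemma megamatroid_submodular:
  assumes "megamatroid rk" "A \<in> finite_ranks rk" "B \<in> finite_ranks rk"
  shows "rv rk (A \<union> B) + rv rk (A \<inter> B) \<le> rv rk A + rv rk B"
proof -
  have "rk (A \<union> B) + rk (A \<inter> B) \<le> rk A + rk B"
    using assms by (metis megamatroid_def megamatroid_is_integer_iff)
  then show ?thesis
    using assms megamatroid_lattice[OF assms] by (simp add: megamatroid_rv)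
qed

lemma in_base_polyhedron_iff:
  assumes "megamatroid rk"
  shows "y \<in> base_polyhedron rk \<longleftrightarrow>
    wt UNIV y = rv rk UNIV \<and> (\<forall>A \<in> finite_ranks rk. wt A y \<le> rv rk A)"
proof -
  have "ereal (wt A y) \<le> rk A \<longleftrightarrow> (A \<in> finite_ranks rk \<longrightarrow> wt A y \<le> rv rk A)" for A
    using megamatroid_rv[OF assms, of A] by (cases "A \<in> finite_ranks rk") (auto simp: finite_ranks_def)
  then show ?thesis
    using megamatroid_rv[OF assms megamatroid_UNIV_finite[OF assms]]
    by (auto simp: base_polyhedron_def wt_def)
qed

lemma base_polyhedron_halfspaces:
  assumes "megamatroid rk"
  shows "base_polyhedron rk = {y. (\<chi> i. of_bool (i \<in> UNIV)) \<bullet> y = rv rk UNIV} \<inter>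
    (\<Inter>A \<in> finite_ranks rk. {y. (\<chi> i. of_bool (i \<in> A)) \<bullet> y \<le> rv rk A})"
  by (auto simp: in_base_polyhedron_iff[OF assms] wt_conv_inner)

lemma convex_base_polyhedron: "megamatroid rk \<Longrightarrow> convex (base_polyhedron rk)"
  unfolding base_polyhedron_halfspaces
  by (intro convex_Int convex_INT convex_hyperplane convex_halfspace_le)

lemma closed_base_polyhedron: "megamatroid rk \<Longrightarrow> closed (base_polyhedron rk)"
  unfolding base_polyhedron_halfspaces
  by (intro closed_Int closed_INT closed_hyperplane closed_halfspace_le ballI)

text \<open>The rank function of the ray sum in direction \<open>dir i j\<close>: the sets that
  contain \<open>i\<close> but not \<open>j\<close> are those whose weight grows along this
  direction, so their constraints are dropped.\<close>

definition link :: "'n \<Rightarrow> 'n \<Rightarrow> ('n set \<Rightarrow> ereal) \<Rightarrow> 'n set \<Rightarrow> ereal" where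
  "link i j rk A = (if i \<in> A \<longrightarrow> j \<in> A then rk A else \<infinity>)"

lemma finite_ranks_link: "finite_ranks (link i j rk) = {A \<in> finite_ranks rk. i \<in> A \<longrightarrow> j \<in> A}"
  by (auto simp: finite_ranks_def link_def)

lemma rv_link: "(i \<in> A \<longrightarrow> j \<in> A) \<Longrightarrow> rv (link i j rk) A = rv rk A"
  by (simp add: rv_def link_def)

lemma rv_link_UNIV [simp]: "rv (link i j rk) UNIV = rv rk UNIV"
  by (simp add: rv_link)

lemma megamatroid_link:
  assumes "megamatroid rk" shows "megamatroid (link i j rk)"
proof -
  have "\<not> is_integer \<infinity>"
    by (auto simp: is_integer_def)
  then show ?thesis
    using assms unfolding megamatroid_def link_def
    by (auto split: if_splits)
qed

lemma link_in_megamatroids: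
  "rk \<in> megamatroids r \<Longrightarrow> link i j rk \<in> megamatroids r"
  by (auto simp: megamatroids_def megamatroid_link) (simp add: link_def)

text \<open>Elimination of \<open>t\<close>: sets containing \<open>i\<close> but not
  \<open>j\<close> give lower bounds on \<open>t\<close>, sets containing \<open>j\<close> but not
  \<open>i\<close> give upper bounds, and submodularity makes the two kinds compatible.\<close>

lemma base_polyhedron_link_iff:
  assumes "megamatroid rk"
  shows "y \<in> base_polyhedron (link i j rk) \<longleftrightarrow> (\<exists>t\<ge>0. y - t *\<^sub>R dir i j \<in> base_polyhedron rk)"
proof
  assume "\<exists>t\<ge>0. y - t *\<^sub>R dir i j \<in> base_polyhedron rk"
  then obtain t where t: "t \<ge> 0" "y - t *\<^sub>R dir i j \<in> base_polyhedron rk" by blast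
  define z where "z = y - t *\<^sub>R dir i j"
  have y: "y = z + t *\<^sub>R dir i j" by (simp add: z_def)
  have z: "wt UNIV z = rv rk UNIV" "\<And>A. A \<in> finite_ranks rk \<Longrightarrow> wt A z \<le> rv rk A"
    using t(2) by (auto simp: in_base_polyhedron_iff[OF assms] z_def)
  show "y \<in> base_polyhedron (link i j rk)"
    unfolding in_base_polyhedron_iff[OF megamatroid_link[OF assms]]
  proof (intro conjI ballI)
    show "wt UNIV y = rv (link i j rk) UNIV" by (simp add: y wt_dir_shift z)
    fix A assume "A \<in> finite_ranks (link i j rk)"
    then have A: "A \<in> finite_ranks rk" "i \<in> A \<longrightarrow> j \<in> A" by (auto simp: finite_ranks_link)
    then have "t * (of_bool (i \<in> A) - of_bool (j \<in> A)) \<le> 0" using t(1) by auto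
    then show "wt A y \<le> rv (link i j rk) A"
      using z(2)[OF A(1)] A(2) by (simp add: y wt_dir_shift rv_link)
  qed
next
  assume y: "y \<in> base_polyhedron (link i j rk)"
  have yU: "wt UNIV y = rv rk UNIV" and yle: "\<And>A. A \<in> finite_ranks rk \<Longrightarrow> (i \<in> A \<longrightarrow> j \<in> A) \<Longrightarrow> wt A y \<le> rv rk A"
    using y by (auto simp: in_base_polyhedron_iff[OF megamatroid_link[OF assms]] finite_ranks_link rv_link)
  \<comment> \<open>The lower bounds that the constraints put on \<open>t\<close>, together with
    0.\<close>
  define S where "S = insert 0 ((\<lambda>A. wt A y - rv rk A) ` {A \<in> finite_ranks rk. i \<in> A \<and> j \<notin> A})"
  have S: "finite S" "S \<noteq> {}" by (auto simp: S_def)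
  define t where "t = Max S"
  have t0: "0 \<le> t" unfolding t_def by (rule Max_ge[OF S(1)]) (simp add: S_def)
  have up: "wt A y - rv rk A \<le> t" if "A \<in> finite_ranks rk" "i \<in> A" "j \<notin> A" for A
    unfolding t_def by (rule Max_ge[OF S(1)]) (use that in \<open>auto simp: S_def\<close>)
  have down: "t \<le> rv rk B - wt B y" if B: "B \<in> finite_ranks rk" "j \<in> B" "i \<notin> B" for B
  proof -
    have "s \<le> rv rk B - wt B y" if "s \<in> S" for s
    proof (cases "s = 0")
      case True
      then show ?thesis using yle[of B] B by simp
    next
      case False
      then obtain A where A: "A \<in> finite_ranks rk" "i \<in> A" "j \<notin> A" "s = wt A y - rv rk A"
        using \<open>s \<in> S\<close> by (auto simp: S_def)
      \<comment> \<open>\<open>A \<union> B\<close> contains both \<open>i\<close> and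
        \<open>j\<close>, and \<open>A \<inter> B\<close> contains neither, so \<open>link\<close>
        keeps both constraints.\<close>
      have "wt A y + wt B y = wt (A \<union> B) y + wt (A \<inter> B) y" by (simp add: wt_modular)
      also have "\<dots> \<le> rv rk (A \<union> B) + rv rk (A \<inter> B)"
        using A B megamatroid_lattice[OF assms A(1) B(1)] by (intro add_mono yle) auto
      also have "\<dots> \<le> rv rk A + rv rk B" by (rule megamatroid_submodular[OF assms A(1) B(1)])
      finally show ?thesis by (simp add: A(4))
    qed
    then show ?thesis unfolding t_def using S by simp
  qed
  have "y - t *\<^sub>R dir i j \<in> base_polyhedron rk"
    unfolding in_base_polyhedron_iff[OF assms]
  proof (intro conjI ballI)
    show "wt UNIV (y - t *\<^sub>R dir i j) = rv rk UNIV"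
      by (simp add: wt_diff wt_scaleR wt_dir yU)
    fix A assume A: "A \<in> finite_ranks rk"
    show "wt A (y - t *\<^sub>R dir i j) \<le> rv rk A"
      using up[OF A] down[OF A] yle[OF A]
      by (cases "i \<in> A"; cases "j \<in> A") (simp_all add: wt_diff wt_scaleR wt_dir)
  qed
  then show "\<exists>t\<ge>0. y - t *\<^sub>R dir i j \<in> base_polyhedron rk" using t0 by blast
qed

definition push :: "'n::finite \<Rightarrow> 'n \<Rightarrow> (real ^ 'n) set \<Rightarrow> (real ^ 'n) set" where
  "push i j P = {y. \<exists>t\<ge>0. y - t *\<^sub>R dir i j \<in> P}"

lemma base_polyhedron_link:
  "megamatroid rk \<Longrightarrow> base_polyhedron (link i j rk) = push i j (base_polyhedron rk)"
  by (auto simp: push_def base_polyhedron_link_iff)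

lemma subset_push: "P \<subseteq> push i j P"
  by (auto simp: push_def intro: exI[of _ 0])

lemma push_mono: "P \<subseteq> R \<Longrightarrow> push i j P \<subseteq> push i j R"
  by (auto simp: push_def)

lemma push_empty [simp]: "push i j {} = {}"
  by (simp add: push_def)

lemma pushI: "y \<in> P \<Longrightarrow> t \<ge> 0 \<Longrightarrow> y + t *\<^sub>R dir i j \<in> push i j P"
  unfolding push_def by force

section \<open>Tight points and recovery of the ranks\<close>

definition open_pairs :: "'n set set \<Rightarrow> ('n \<times> 'n) set" where
  "open_pairs S = {(i, j). (\<exists>A\<in>S. i \<in> A \<and> j \<notin> A) \<and> (\<exists>A\<in>S. j \<in> A \<and> i \<notin> A)}"

lemma open_pairs_empty_chain:
  "open_pairs S = {} \<Longrightarrow> A \<in> S \<Longrightarrow> B \<in> S \<Longrightarrow> A \<subseteq> B \<or> B \<subseteq> A"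
  unfolding open_pairs_def by blast

text \<open>The measure for the inductions on linking: a subfamily opens no new pair, and either
  restriction removes all sets separating \<open>i\<close> from \<open>j\<close> in one of the two
  orders, which closes \<open>(i, j)\<close>.\<close>

lemma card_open_pairs_less:
  fixes S :: "'n::finite set set"
  assumes "(i, j) \<in> open_pairs S"
    and "S' \<subseteq> {A \<in> S. i \<in> A \<longrightarrow> j \<in> A} \<or> S' \<subseteq> {A \<in> S. j \<in> A \<longrightarrow> i \<in> A}"
  shows "card (open_pairs S') < card (open_pairs S)"
proof (rule psubset_card_mono)
  show "open_pairs S' \<subset> open_pairs S"
    using assms unfolding open_pairs_def by blast
qed simp

text \<open>Induction from the top of the chain: a nonempty largest member has an element outside
  all the others, and changing that coordinate corrects its weight without affecting theirs.\<close>

lemma exists_wt_chain: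
  fixes C :: "'n::finite set set" and v :: "'n set \<Rightarrow> real"
  assumes "\<And>A B. A \<in> C \<Longrightarrow> B \<in> C \<Longrightarrow> A \<subseteq> B \<or> B \<subseteq> A" and "v {} = 0"
  shows "\<exists>y. \<forall>A\<in>C. wt A y = v A"
proof -
  show ?thesis using assms(1)
  proof (induction "card C" arbitrary: C)
    case 0
    then show ?case by auto
  next
    case (Suc m)
    then have "C \<noteq> {}" by auto
    then obtain M where M: "M \<in> C" "\<And>A. A \<in> C \<Longrightarrow> M \<subseteq> A \<Longrightarrow> A = M"
      using finite_has_maximal[of C] by auto
    then have sub: "A \<subseteq> M" if "A \<in> C" for A using Suc.prems[OF that M(1)] that by blast
    have "m = card (C - {M})" using Suc.hyps(2) M(1) by (metis card_Diff_singleton diff_Suc_1)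
    then obtain y where y: "\<forall>A\<in>C - {M}. wt A y = v A"
      using Suc.hyps(1)[of "C - {M}"] Suc.prems by auto
    show ?case
    proof (cases "\<Union>(C - {M}) = M")
      case True
      \<comment> \<open>If there are other members and they cover \<open>M\<close>, the largest of
        them would be \<open>M\<close> itself; if there are none, \<open>M\<close> is empty.\<close>
      have "M \<in> C - {M} \<or> M = {}"
      proof (cases "C - {M} = {}")
        case False
        obtain N where N: "N \<in> C - {M}" "\<And>A. A \<in> C - {M} \<Longrightarrow> N \<subseteq> A \<Longrightarrow> A = N"
          using False by (metis finite_has_maximal finite)
        then have "A \<subseteq> N" if "A \<in> C - {M}" for A using Suc.prems[of A N] that by blast
        then have "N = M" using True N(1) by blast
        then show ?thesis using N by simp
      qed (use True in auto)
      then have "M = {}" by simp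
      then show ?thesis using y \<open>v {} = 0\<close> by (auto intro!: exI[of _ y])
    next
      case False
      then obtain e where e: "e \<in> M" "e \<notin> \<Union>(C - {M})" using sub by blast
      define z where "z = y + (v M - wt M y) *\<^sub>R axis e 1"
      have ax: "wt A (axis e 1) = of_bool (e \<in> A)" for A
        by (simp add: wt_def axis_def)
      have "wt A z = v A" if "A \<in> C" for A
      proof (cases "A = M")
        case True then show ?thesis using e by (simp add: z_def wt_add wt_scaleR ax)
      next
        case False
        then have "e \<notin> A" using e that by blast
        then show ?thesis using y that False by (simp add: z_def wt_add wt_scaleR ax)
      qed
      then show ?thesis by blast
    qed
  qed
qed

text \<open>Linking \<open>i\<close> and \<open>j\<close> pushes points in a direction along which the weight of \<open>A\<close> cannot increase.\<close>

lemma base_polyhedron_tight: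
  assumes "megamatroid rk" "A \<in> finite_ranks rk"
  shows "\<exists>y \<in> base_polyhedron rk. wt A y = rv rk A"
  using assms
proof (induction "card (open_pairs (finite_ranks rk))" arbitrary: rk rule: less_induct)
  case less
  note mega = \<open>megamatroid rk\<close>
  show ?case
  proof (cases "open_pairs (finite_ranks rk) = {}")
    case True
    obtain y where y: "\<forall>A\<in>finite_ranks rk. wt A y = rv rk A"
      using exists_wt_chain[of "finite_ranks rk" "rv rk"] open_pairs_empty_chain[OF True]
        megamatroid_rv_empty[OF mega] by blast
    then have "y \<in> base_polyhedron rk"
      by (simp add: in_base_polyhedron_iff[OF mega] megamatroid_UNIV_finite[OF mega])
    then show ?thesis using y less.prems by blast
  next
    case False
    then obtain i j where ij: "(i, j) \<in> open_pairs (finite_ranks rk)" by auto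
    \<comment> \<open>At least one of \<open>i \<in> A \<longrightarrow> j \<in> A\<close> and
      \<open>j \<in> A \<longrightarrow> i \<in> A\<close> holds, so \<open>A\<close> keeps its
      finite rank under one of the two links. The claim is therefore stated for both orders of the
      pair.\<close>
    have *: "\<exists>y \<in> base_polyhedron rk. wt A y = rv rk A"
      if cl: "i \<in> A \<longrightarrow> j \<in> A" and op: "(i, j) \<in> open_pairs (finite_ranks rk) \<or> (j, i) \<in> open_pairs (finite_ranks rk)" for i j
    proof -
      have "card (open_pairs (finite_ranks (link i j rk))) < card (open_pairs (finite_ranks rk))"
        using op card_open_pairs_less[of i j "finite_ranks rk" "finite_ranks (link i j rk)"]
          card_open_pairs_less[of j i "finite_ranks rk" "finite_ranks (link i j rk)"]
        by (auto simp: finite_ranks_link)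
      from less.hyps[OF this megamatroid_link[OF mega]] obtain y
        where y: "y \<in> base_polyhedron (link i j rk)" "wt A y = rv rk A"
        using less.prems(2) cl by (auto simp: finite_ranks_link rv_link[OF cl])
      then obtain t where t: "t \<ge> 0" "y - t *\<^sub>R dir i j \<in> base_polyhedron rk"
        by (auto simp: base_polyhedron_link_iff[OF mega])
      have "wt A (y - t *\<^sub>R dir i j) \<ge> rv rk A"
        using t(1) cl y(2) by (auto simp: wt_diff wt_scaleR wt_dir)
      moreover have "wt A (y - t *\<^sub>R dir i j) \<le> rv rk A"
        using t(2) less.prems(2) by (simp add: in_base_polyhedron_iff[OF mega])
      ultimately show ?thesis using t(2) by force
    qed
    show ?thesis
      using *[of i j] *[of j i] ij by blast
  qed
qed

lemma base_polyhedron_nonempty: "megamatroid rk \<Longrightarrow> base_polyhedron rk \<noteq> {}"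
  using base_polyhedron_tight megamatroid_empty_finite by blast

text \<open>The equation \<open>link i j rk = rk\<close> says that the base polyhedron is closed
  under moving in direction \<open>dir i j\<close>. If it fails for all \<open>i\<close> in
  \<open>A\<close> and \<open>j\<close> outside, every such pair is separated by a set of finite
  rank, and \<open>A\<close> is a union of intersections of these sets, hence of finite
  rank.\<close>

lemma infinite_rank_direction:
  fixes rk :: "'n::finite set \<Rightarrow> ereal"
  assumes mega: "megamatroid rk" and A: "A \<notin> finite_ranks rk"
  shows "\<exists>i\<in>A. \<exists>j. j \<notin> A \<and> link i j rk = rk"
proof (rule ccontr)
  assume "\<not> ?thesis"
  then have ne: "link i j rk \<noteq> rk" if "i \<in> A" "j \<notin> A" for i j using that by blast
  have "\<exists>B\<in>finite_ranks rk. i \<in> B \<and> j \<notin> B" if "i \<in> A" "j \<notin> A" for i j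
    using ne[OF that] unfolding link_def finite_ranks_def fun_eq_iff by (metis (mono_tags) mem_Collect_eq)
  then obtain B where B: "\<And>i j. i \<in> A \<Longrightarrow> j \<notin> A \<Longrightarrow> B i j \<in> finite_ranks rk \<and> i \<in> B i j \<and> j \<notin> B i j"
    by metis
  have inter: "(\<Inter>j\<in>J. B i j) \<in> finite_ranks rk" if "J \<subseteq> -A" "i \<in> A" for i J
  proof -
    have "finite J" by simp
    then show ?thesis using that(1)
      by induction (use that(2) B in \<open>auto simp: megamatroid_UNIV_finite[OF mega] intro!: megamatroid_lattice[OF mega]\<close>)
  qed
  have "(\<Union>i\<in>I. \<Inter>j\<in>-A. B i j) \<in> finite_ranks rk" if "I \<subseteq> A" for I
  proof -
    have "finite I" by simp
    then show ?thesis using that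
      by induction (use inter in \<open>auto simp: megamatroid_empty_finite[OF mega] intro!: megamatroid_lattice[OF mega]\<close>)
  qed
  from this[of A] have "(\<Union>i\<in>A. \<Inter>j\<in>-A. B i j) \<in> finite_ranks rk" by simp
  moreover have "(\<Union>i\<in>A. \<Inter>j\<in>-A. B i j) = A"
  proof
    show "(\<Union>i\<in>A. \<Inter>j\<in>-A. B i j) \<subseteq> A" using B by fastforce
    show "A \<subseteq> (\<Union>i\<in>A. \<Inter>j\<in>-A. B i j)" using B by blast
  qed
  ultimately show False using A by simp
qed

text \<open>If the rank of \<open>A\<close> were infinite, \<open>wt A\<close> would grow without
  bound along a ray of the polyhedron; if it is finite, it is attained at a tight point.\<close>

lemma finite_rank_if_bounded:
  assumes mega: "megamatroid rk" and bd: "\<And>y. y \<in> base_polyhedron rk \<Longrightarrow> wt A y \<le> c"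
  shows "A \<in> finite_ranks rk \<and> rv rk A \<le> c"
proof
  show fin: "A \<in> finite_ranks rk"
  proof (rule ccontr)
    assume "A \<notin> finite_ranks rk"
    then obtain i j where ij: "i \<in> A" "j \<notin> A" "link i j rk = rk"
      using infinite_rank_direction[OF mega] by blast
    obtain y where y: "y \<in> base_polyhedron rk" using base_polyhedron_nonempty[OF mega] by blast
    \<comment> \<open>The ray length is chosen so that the weight of \<open>A\<close> becomes
      \<open>c + 1\<close>.\<close>
    have "y + (c - wt A y + 1) *\<^sub>R dir i j \<in> base_polyhedron (link i j rk)"
      unfolding base_polyhedron_link[OF mega] using bd[OF y] by (intro pushI y) auto
    from bd[OF this[unfolded ij(3)]] show False
      using ij by (simp add: wt_dir_shift)
  qed
  then show "rv rk A \<le> c" using base_polyhedron_tight[OF mega fin] bd by force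
qed

text \<open>\<open>rk A\<close> is the supremum of \<open>wt A\<close> over the base polyhedron.
  This is what makes \<open>megamatroid_of\<close> well defined.\<close>

lemma base_polyhedron_mono_rank:
  assumes "megamatroid rk" "megamatroid rk'" "base_polyhedron rk \<subseteq> base_polyhedron rk'"
  shows "rk A \<le> rk' A"
proof (cases "A \<in> finite_ranks rk'")
  case True
  then have "A \<in> finite_ranks rk \<and> rv rk A \<le> rv rk' A"
    using assms(3) by (intro finite_rank_if_bounded[OF assms(1)]) (auto simp: in_base_polyhedron_iff[OF assms(2)])
  then show ?thesis using True assms by (simp add: megamatroid_rv)
qed (simp add: finite_ranks_def)

lemma base_polyhedron_inject:
  assumes "megamatroid rk" "megamatroid rk'" "base_polyhedron rk = base_polyhedron rk'"
  shows "rk = rk'"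
  using base_polyhedron_mono_rank[OF assms(1,2)] base_polyhedron_mono_rank[OF assms(2,1)] assms(3)
  by (intro ext antisym) auto

lemma megamatroid_of_base_polyhedron:
  "megamatroid rk \<Longrightarrow> megamatroid_of (base_polyhedron rk) = rk"
  unfolding megamatroid_of_def by (rule the_equality) (auto intro: base_polyhedron_inject)

section \<open>Faces of base polyhedra\<close>

lemma megamatroidI:
  assumes "\<And>A. A \<in> L \<Longrightarrow> rk A = ereal (of_int (z A))" "\<And>A. A \<notin> L \<Longrightarrow> rk A = \<infinity>"
    and "{} \<in> L" "z {} = 0" "UNIV \<in> L"
    and "\<And>A B. A \<in> L \<Longrightarrow> B \<in> L \<Longrightarrow> A \<union> B \<in> L \<and> A \<inter> B \<in> L \<and> z (A \<union> B) + z (A \<inter> B) \<le> z A + z B"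
  shows "megamatroid rk"
proof -
  have L: "is_integer (rk A) \<longleftrightarrow> A \<in> L" for A
    using assms(1,2)[of A] by (cases "A \<in> L") (auto simp: is_integer_def)
  have "rk (A \<union> B) + rk (A \<inter> B) \<le> rk A + rk B" if "A \<in> L" "B \<in> L" for A B
    using that assms(6)[OF that] by (simp add: assms(1) flip: of_int_add)
  then show ?thesis
    unfolding megamatroid_def L using assms by (auto simp: zero_ereal_def)
qed

text \<open>The face where \<open>B\<close> is tight belongs to the direct sum of the restriction to \<open>B\<close> and the contraction of \<open>B\<close>.\<close>

lemma megamatroid_polyhedron_face:
  assumes mega: "megamatroid rk" and le: "\<And>y. y \<in> base_polyhedron rk \<Longrightarrow> wt B y \<le> c"
    and ne: "{y \<in> base_polyhedron rk. wt B y = c} \<noteq> {}"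
  shows "megamatroid_polyhedron {y \<in> base_polyhedron rk. wt B y = c}"
proof -
  have B: "B \<in> finite_ranks rk" and "rv rk B \<le> c"
    using finite_rank_if_bounded[OF mega le] by auto
  with ne have c: "c = rv rk B"
    by (fastforce simp: in_base_polyhedron_iff[OF mega])
  define L where "L = {D. B \<inter> D \<in> finite_ranks rk \<and> B \<union> D \<in> finite_ranks rk}"
  \<comment> \<open>The restriction to \<open>B\<close> contributes
    \<open>rv rk (B \<inter> D)\<close>, the contraction
    \<open>rv rk (B \<union> D) - rv rk B\<close>.\<close>
  define v where "v D = rv rk (B \<inter> D) + rv rk (B \<union> D) - rv rk B" for D
  define rk' where "rk' D = (if D \<in> L then ereal (v D) else \<infinity>)" for D
  have "\<exists>z::int. A \<in> finite_ranks rk \<longrightarrow> rv rk A = of_int z" for A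
    using megamatroid_rv[OF mega, of A] megamatroid_is_integer_iff[OF mega, of A]
    by (metis is_integer_def ereal.inject)
  then obtain z :: "_ \<Rightarrow> int" where z: "\<And>A. A \<in> finite_ranks rk \<Longrightarrow> rv rk A = of_int (z A)" by metis
  have v_sub: "D \<union> E \<in> L \<and> D \<inter> E \<in> L \<and> v (D \<union> E) + v (D \<inter> E) \<le> v D + v E"
    if "D \<in> L" "E \<in> L" for D E
  proof -
    have eq: "B \<inter> (D \<union> E) = (B \<inter> D) \<union> (B \<inter> E)" "B \<inter> (D \<inter> E) = (B \<inter> D) \<inter> (B \<inter> E)"
      "B \<union> (D \<union> E) = (B \<union> D) \<union> (B \<union> E)" "B \<union> (D \<inter> E) = (B \<union> D) \<inter> (B \<union> E)" by auto
    show ?thesis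
      using that megamatroid_lattice[OF mega, of "B \<inter> D" "B \<inter> E"]
        megamatroid_lattice[OF mega, of "B \<union> D" "B \<union> E"]
        megamatroid_submodular[OF mega, of "B \<inter> D" "B \<inter> E"]
        megamatroid_submodular[OF mega, of "B \<union> D" "B \<union> E"]
      unfolding L_def v_def mem_Collect_eq eq by linarith
  qed
  have mega': "megamatroid rk'"
  proof (rule megamatroidI[where L = L and z = "\<lambda>D. z (B \<inter> D) + z (B \<union> D) - z B"])
    show "rk' A = ereal (of_int (z (B \<inter> A) + z (B \<union> A) - z B))" if "A \<in> L" for A
      using that B by (simp add: rk'_def v_def L_def z)
    show "{} \<in> L" "UNIV \<in> L"
      using B mega by (auto simp: L_def megamatroid_empty_finite megamatroid_UNIV_finite)
    show "z (B \<inter> {}) + z (B \<union> {}) - z B = 0"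
      using z[OF megamatroid_empty_finite[OF mega]] mega by (simp add: megamatroid_rv_empty)
    show "A \<union> D \<in> L \<and> A \<inter> D \<in> L \<and>
        z (B \<inter> (A \<union> D)) + z (B \<union> (A \<union> D)) - z B + (z (B \<inter> (A \<inter> D)) + z (B \<union> (A \<inter> D)) - z B)
        \<le> z (B \<inter> A) + z (B \<union> A) - z B + (z (B \<inter> D) + z (B \<union> D) - z B)"
      if "A \<in> L" "D \<in> L" for A D
    proof -
      have v_z: "v E = of_int (z (B \<inter> E) + z (B \<union> E) - z B)" if "E \<in> L" for E
        using that B by (simp add: v_def L_def z)
      have l: "A \<union> D \<in> L" "A \<inter> D \<in> L" "v (A \<union> D) + v (A \<inter> D) \<le> v A + v D"
        using v_sub[OF that] by auto
      then show ?thesis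
        unfolding v_z[OF l(1)] v_z[OF l(2)] v_z[OF that(1)] v_z[OF that(2)] by linarith
    qed
  qed (simp add: rk'_def)
  have fr: "finite_ranks rk' = L" and rv: "\<And>D. D \<in> L \<Longrightarrow> rv rk' D = v D"
    by (auto simp: finite_ranks_def rk'_def rv_def)
  have UL: "UNIV \<in> L" and UB: "v UNIV = rv rk UNIV" and BL: "B \<in> L" and vB: "v B = rv rk B"
    using B mega by (auto simp: L_def v_def megamatroid_UNIV_finite)
  have "y \<in> base_polyhedron rk' \<longleftrightarrow> y \<in> base_polyhedron rk \<and> wt B y = c" for y
  proof
    assume y: "y \<in> base_polyhedron rk \<and> wt B y = c"
    have "wt D y \<le> v D" if "D \<in> L" for D
    proof -
      have "wt D y = wt (B \<inter> D) y + wt (B \<union> D) y - wt B y"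
        using wt_modular[of B D y] by simp
      also have "\<dots> \<le> v D"
        using y that by (auto simp: v_def c L_def in_base_polyhedron_iff[OF mega] intro!: add_mono)
      finally show ?thesis .
    qed
    then show "y \<in> base_polyhedron rk'"
      using y by (simp add: in_base_polyhedron_iff[OF mega'] in_base_polyhedron_iff[OF mega] fr rv UL UB)
  next
    assume "y \<in> base_polyhedron rk'"
    then have yU: "wt UNIV y = rv rk UNIV" and yL: "\<And>D. D \<in> L \<Longrightarrow> wt D y \<le> v D"
      by (auto simp: in_base_polyhedron_iff[OF mega'] fr rv UL UB)
    \<comment> \<open>The constraint of \<open>-B\<close> and the fixed total weight bound
      \<open>wt B y\<close> from below by \<open>rv rk B\<close>, so \<open>B\<close> is
      tight.\<close>
    have "-B \<in> L" "v (-B) = rv rk UNIV - rv rk B"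
      using mega by (auto simp: L_def v_def megamatroid_empty_finite megamatroid_UNIV_finite megamatroid_rv_empty)
    moreover have "wt (-B) y + wt B y = wt UNIV y"
      using wt_modular[of "-B" B y] by (simp add: Un_commute)
    ultimately have yB: "wt B y = c"
      using yL[of "-B"] yL[OF BL] yU by (simp add: c vB)
    have "wt D y \<le> rv rk D" if D: "D \<in> finite_ranks rk" for D
    proof -
      note l = megamatroid_lattice[OF mega B D]
      have "wt D y = wt (B \<inter> D) y + wt (B \<union> D) y - c"
        using wt_modular[of B D y] yB by simp
      also have "\<dots> \<le> v (B \<inter> D) + v (B \<union> D) - c"
        using l B by (intro diff_right_mono add_mono yL) (auto simp: L_def Un_absorb2 Int_absorb2)
      also have "\<dots> = rv rk (B \<inter> D) + rv rk (B \<union> D) - rv rk B"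
        by (simp add: v_def c Un_absorb2 Int_absorb2)
      also have "\<dots> \<le> rv rk D" using megamatroid_submodular[OF mega B D] by simp
      finally show ?thesis .
    qed
    then show "y \<in> base_polyhedron rk \<and> wt B y = c"
      using yU yB by (simp add: in_base_polyhedron_iff[OF mega])
  qed
  then show ?thesis
    unfolding megamatroid_polyhedron_def using mega' by blast
qed

definition tight_face :: "('n::finite set \<Rightarrow> ereal) \<Rightarrow> 'n set \<Rightarrow> (real ^ 'n) set" where
  "tight_face rk A = {y \<in> base_polyhedron rk. wt A y = rv rk A}"

lemma tight_face_subset: "tight_face rk A \<subseteq> base_polyhedron rk"
  by (auto simp: tight_face_def)

text \<open>The constraints are made tight one at a time: that of \<open>B q\<close> is still valid
  on the face already cut out, so \<open>megamatroid_polyhedron_face\<close> applies to that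
  face.\<close>

lemma megamatroid_polyhedron_tight_faces:
  assumes mega: "megamatroid rk" and "finite I" "I \<noteq> {}" "B ` I \<subseteq> finite_ranks rk"
    and "(\<Inter>q\<in>I. tight_face rk (B q)) \<noteq> {}"
  shows "megamatroid_polyhedron (\<Inter>q\<in>I. tight_face rk (B q))"
  using assms(2-)
proof (induction I rule: finite_ne_induct)
  case (singleton q)
  then show ?case
    using megamatroid_polyhedron_face[OF mega, of "B q" "rv rk (B q)"]
    by (auto simp: tight_face_def in_base_polyhedron_iff[OF mega])
next
  case (insert q I)
  let ?G = "\<Inter>q\<in>I. tight_face rk (B q)"
  have "?G \<noteq> {}" using insert.prems by auto
  then obtain rk' where rk': "megamatroid rk'" "base_polyhedron rk' = ?G"
    using insert unfolding megamatroid_polyhedron_def by auto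
  have sub: "?G \<subseteq> base_polyhedron rk"
    using insert.hyps tight_face_subset by fastforce
  have eq: "(\<Inter>q\<in>insert q I. tight_face rk (B q)) = {y \<in> base_polyhedron rk'. wt (B q) y = rv rk (B q)}"
    using sub by (auto simp: rk' tight_face_def)
  show ?case
    unfolding eq
  proof (rule megamatroid_polyhedron_face[OF rk'(1)])
    show "{y \<in> base_polyhedron rk'. wt (B q) y = rv rk (B q)} \<noteq> {}"
      using insert.prems eq by simp
    show "wt (B q) y \<le> rv rk (B q)" if "y \<in> base_polyhedron rk'" for y
      using that sub insert.prems unfolding rk' by (auto simp: in_base_polyhedron_iff[OF mega])
  qed
qed

lemma megamatroid_polyhedron_push:
  "megamatroid_polyhedron P \<Longrightarrow> megamatroid_polyhedron (push i j P)"
  unfolding megamatroid_polyhedron_def by (metis base_polyhedron_link megamatroid_link)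

lemma megamatroid_polyhedron_nonempty: "megamatroid_polyhedron P \<Longrightarrow> P \<noteq> {}"
  unfolding megamatroid_polyhedron_def using base_polyhedron_nonempty by blast

section \<open>Decomposing a ray sum\<close>

definition cell_symbol :: "(real ^ 'n::finite) set \<Rightarrow> (('n set \<Rightarrow> ereal) \<Rightarrow>\<^sub>0 int)" where
  "cell_symbol X = (if X = {} then 0 else frag_of (megamatroid_of X))"

lemma cell_symbol_base_polyhedron:
  "megamatroid rk \<Longrightarrow> cell_symbol (base_polyhedron rk) = frag_of rk"
  by (simp add: cell_symbol_def base_polyhedron_nonempty megamatroid_of_base_polyhedron)

lemma m_val_cell_symbol:
  "m_val P k Q = (\<Sum>I\<in>Pow {1..k}. frag_cmul ((-1) ^ card I) (cell_symbol (cell P Q I)))"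
  by (simp add: m_val_def cell_symbol_def)

lemma frag_cmul_diff: "frag_cmul c (a - b) = frag_cmul c a + frag_cmul (- c) b"
  by (rule poly_mapping_eqI) (simp add: lookup_add lookup_minus algebra_simps)

text \<open>The elements that a weakly valuative map has to kill.\<close>

definition decomposition_relations :: "int \<Rightarrow> (('n::finite set \<Rightarrow> ereal) \<Rightarrow>\<^sub>0 int) set" where
  "decomposition_relations r = {m_val P k Q |P k Q. megamatroid_decomposition P k Q \<and>
     cells_megamatroidal P k Q \<and> P \<subseteq> {y. (\<Sum>i\<in>UNIV. y $ i) = of_int r}}"

text \<open>
  The sets \<open>B 1, \<dots>, B k\<close> cut out the maximal faces through which a point of the base
  polyhedron can leave it in direction \<open>dir i j\<close>.
\<close>

locale exit_faces =
  fixes rk :: "'n::finite set \<Rightarrow> ereal" and i j :: 'n and k :: nat and B :: "nat \<Rightarrow> 'n set"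
  assumes mega: "megamatroid rk"
    and B: "q \<in> {1..k} \<Longrightarrow> B q \<in> finite_ranks rk \<and> i \<in> B q \<and> j \<notin> B q"
    and exit: "A \<in> finite_ranks rk \<Longrightarrow> i \<in> A \<Longrightarrow> j \<notin> A \<Longrightarrow>
      \<exists>q\<in>{1..k}. tight_face rk A \<subseteq> tight_face rk (B q)"
    and antichain: "p \<in> {1..k} \<Longrightarrow> q \<in> {1..k} \<Longrightarrow>
      tight_face rk (B p) \<subseteq> tight_face rk (B q) \<Longrightarrow> p = q"
begin

abbreviation (input) F :: "nat \<Rightarrow> (real ^ 'n) set" where
  "F q \<equiv> tight_face rk (B q)"

text \<open>Moving back from \<open>y\<close> by \<open>t\<close> lowers \<open>wt (B q)\<close> by
  exactly \<open>t\<close>. The point reached on \<open>F p\<close> satisfies the constraint of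
  \<open>B q\<close>, so \<open>t q \<le> t p\<close>; by symmetry all these lengths agree, and one
  point lies on all the faces.\<close>

lemma push_tight_faces_Inter:
  assumes "J \<subseteq> {1..k}" "J \<noteq> {}"
  shows "(\<Inter>q\<in>J. push i j (F q)) = push i j (\<Inter>q\<in>J. F q)"
proof
  show "push i j (\<Inter>q\<in>J. F q) \<subseteq> (\<Inter>q\<in>J. push i j (F q))"
    by (auto simp: push_def)
  show "(\<Inter>q\<in>J. push i j (F q)) \<subseteq> push i j (\<Inter>q\<in>J. F q)"
  proof
    fix y assume "y \<in> (\<Inter>q\<in>J. push i j (F q))"
    then have "\<forall>q\<in>J. \<exists>t\<ge>0. y - t *\<^sub>R dir i j \<in> F q" by (auto simp: push_def)
    then obtain t where t: "\<And>q. q \<in> J \<Longrightarrow> t q \<ge> 0 \<and> y - t q *\<^sub>R dir i j \<in> F q" by metis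
    have wt: "wt (B q) (y - t p *\<^sub>R dir i j) = wt (B q) y - t p" if "q \<in> J" for p q
      using B[of q] that assms(1) by (auto simp: wt_diff wt_scaleR wt_dir)
    have le: "t q \<le> t p" if "p \<in> J" "q \<in> J" for p q
    proof -
      have "y - t p *\<^sub>R dir i j \<in> base_polyhedron rk"
        using t[OF that(1)] by (simp add: tight_face_def)
      then have "wt (B q) y - t p \<le> rv rk (B q)"
        using B[of q] that assms(1) by (auto simp: in_base_polyhedron_iff[OF mega] wt[OF that(2), symmetric])
      moreover have "wt (B q) y - t q = rv rk (B q)"
        using t[OF that(2)] by (simp add: tight_face_def wt[OF that(2)])
      ultimately show ?thesis by simp
    qed
    obtain p where p: "p \<in> J" using assms(2) by blast
    have "y - t p *\<^sub>R dir i j \<in> F q" if "q \<in> J" for q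
      using t[OF that] le[OF p that] le[OF that p] by simp
    then show "y \<in> push i j (\<Inter>q\<in>J. F q)" using t[OF p] by (auto simp: push_def)
  qed
qed

text \<open>A ray of length \<open>t\<close> from \<open>F q\<close> ends at weight
  \<open>rv rk (B q) + t\<close> of \<open>B q\<close>, which is allowed in the base polyhedron only
  for \<open>t = 0\<close>.\<close>

lemma base_polyhedron_Int_push:
  assumes "q \<in> {1..k}" shows "base_polyhedron rk \<inter> push i j (F q) = F q"
proof
  show "F q \<subseteq> base_polyhedron rk \<inter> push i j (F q)"
    using tight_face_subset subset_push by blast
  show "base_polyhedron rk \<inter> push i j (F q) \<subseteq> F q"
  proof
    fix y assume y: "y \<in> base_polyhedron rk \<inter> push i j (F q)"
    then obtain t where t: "t \<ge> 0" "y - t *\<^sub>R dir i j \<in> F q" by (auto simp: push_def)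
    have "wt (B q) y - t = rv rk (B q)"
      using t(2) B[OF assms] by (simp add: tight_face_def wt_diff wt_scaleR wt_dir)
    moreover have "wt (B q) y \<le> rv rk (B q)"
      using y B[OF assms] by (simp add: in_base_polyhedron_iff[OF mega])
    ultimately have "t = 0" using t(1) by simp
    then show "y \<in> F q" using t(2) by simp
  qed
qed

text \<open>A ray that ends outside the base polyhedron leaves it through some exit face, and the
  rest of the ray lies in the piece over that face.\<close>

lemma push_eq_Union:
  "push i j (base_polyhedron rk) = base_polyhedron rk \<union> (\<Union>q\<in>{1..k}. push i j (F q))"
proof
  show "base_polyhedron rk \<union> (\<Union>q\<in>{1..k}. push i j (F q)) \<subseteq> push i j (base_polyhedron rk)"
    using subset_push push_mono[OF tight_face_subset] by blast
  show "push i j (base_polyhedron rk) \<subseteq> base_polyhedron rk \<union> (\<Union>q\<in>{1..k}. push i j (F q))"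
  proof
    fix y assume "y \<in> push i j (base_polyhedron rk)"
    then obtain s where s: "s \<ge> 0" "y - s *\<^sub>R dir i j \<in> base_polyhedron rk" by (auto simp: push_def)
    define z where "z = y - s *\<^sub>R dir i j"
    have y: "y = z + s *\<^sub>R dir i j" by (simp add: z_def)
    have zU: "wt UNIV z = rv rk UNIV" and zle: "\<And>A. A \<in> finite_ranks rk \<Longrightarrow> wt A z \<le> rv rk A"
      using s(2) by (auto simp: z_def in_base_polyhedron_iff[OF mega])
    define \<A> where "\<A> = {A \<in> finite_ranks rk. i \<in> A \<and> j \<notin> A}"
    \<comment> \<open>Along \<open>dir i j\<close> only the constraints of sets in
      \<open>\<A>\<close> can become violated.\<close>
    have inQ: "z + t *\<^sub>R dir i j \<in> base_polyhedron rk"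
      if "t \<ge> 0" "\<And>A. A \<in> \<A> \<Longrightarrow> t \<le> rv rk A - wt A z" for t
      unfolding in_base_polyhedron_iff[OF mega]
    proof (intro conjI ballI)
      fix A assume A: "A \<in> finite_ranks rk"
      show "wt A (z + t *\<^sub>R dir i j) \<le> rv rk A"
        using that(1) that(2)[of A] zle[OF A] A
        by (cases "i \<in> A"; cases "j \<in> A") (auto simp: wt_dir_shift \<A>_def)
    qed (simp add: wt_dir_shift zU)
    show "y \<in> base_polyhedron rk \<union> (\<Union>q\<in>{1..k}. push i j (F q))"
    proof (cases "\<forall>A\<in>\<A>. s \<le> rv rk A - wt A z")
      case True
      then show ?thesis using inQ[OF s(1)] y by blast
    next
      case False
      \<comment> \<open>The smallest slack is the length at which the ray from \<open>z\<close>
        leaves the base polyhedron; a set attaining it is tight there.\<close>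
      define t where "t = Min ((\<lambda>A. rv rk A - wt A z) ` \<A>)"
      have ne: "\<A> \<noteq> {}" using False by auto
      have "t \<in> (\<lambda>A. rv rk A - wt A z) ` \<A>" unfolding t_def by (rule Min_in) (use ne in auto)
      then obtain A where A: "A \<in> \<A>" "t = rv rk A - wt A z" by auto
      have tle: "t \<le> rv rk C - wt C z" if "C \<in> \<A>" for C
        unfolding t_def by (rule Min_le) (use that in auto)
      have t0: "t \<ge> 0" using A zle[of A] by (auto simp: \<A>_def)
      have ts: "t \<le> s" using False tle by force
      have "z + t *\<^sub>R dir i j \<in> tight_face rk A"
        using inQ[OF t0 tle] A by (auto simp: tight_face_def wt_dir_shift \<A>_def)
      then obtain q where q: "q \<in> {1..k}" "z + t *\<^sub>R dir i j \<in> F q"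
        using exit[of A] A by (auto simp: \<A>_def)
      have "y = (z + t *\<^sub>R dir i j) + (s - t) *\<^sub>R dir i j"
        by (simp add: y algebra_simps)
      then have "y \<in> push i j (F q)" using pushI[OF q(2), of "s - t" i j] ts by simp
      then show ?thesis using q(1) by blast
    qed
  qed
qed

lemma face_of_base_polyhedron:
  assumes "q \<in> {1..k}" shows "F q face_of base_polyhedron rk"
proof -
  have "base_polyhedron rk \<inter> {y. (\<chi> l. of_bool (l \<in> B q)) \<bullet> y = rv rk (B q)} face_of base_polyhedron rk"
    using B[OF assms]
    by (intro face_of_Int_supporting_hyperplane_le convex_base_polyhedron mega)
      (simp add: in_base_polyhedron_iff[OF mega] flip: wt_conv_inner)
  then show ?thesis by (simp add: tight_face_def Int_def flip: wt_conv_inner)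
qed

lemma megamatroid_polyhedron_F:
  assumes "q \<in> {1..k}" shows "megamatroid_polyhedron (F q)"
proof -
  have "F q \<noteq> {}" using base_polyhedron_tight[OF mega, of "B q"] B[OF assms] by (auto simp: tight_face_def)
  then show ?thesis
    using megamatroid_polyhedron_tight_faces[OF mega, of "{q}" B] B[OF assms] by auto
qed

lemma convex_push_F:
  assumes "q \<in> {1..k}" shows "convex (push i j (F q))"
  using megamatroid_polyhedron_push[OF megamatroid_polyhedron_F[OF assms], of i j] convex_base_polyhedron
  unfolding megamatroid_polyhedron_def by metis

lemma push_F_wt:
  assumes "q \<in> {1..k}" "y \<in> push i j (F q)"
  obtains t where "t \<ge> 0" "y - t *\<^sub>R dir i j \<in> F q" "wt (B q) y = rv rk (B q) + t"
proof -
  obtain t where t: "t \<ge> 0" "y - t *\<^sub>R dir i j \<in> F q" using assms(2) by (auto simp: push_def)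
  then have "wt (B q) y = rv rk (B q) + t"
    using B[OF assms(1)] by (simp add: tight_face_def wt_diff wt_scaleR wt_dir)
  then show thesis using t that by blast
qed

text \<open>\<open>wt (B q)\<close> attains its minimum over the piece exactly at ray length
  0.\<close>

lemma face_of_push_F:
  assumes "q \<in> {1..k}" shows "F q face_of push i j (F q)"
proof -
  have "push i j (F q) \<inter> {y. (\<chi> l. of_bool (l \<in> B q)) \<bullet> y = rv rk (B q)} face_of push i j (F q)"
    by (intro face_of_Int_supporting_hyperplane_ge convex_push_F assms)
      (auto simp flip: wt_conv_inner elim: push_F_wt[OF assms])
  moreover have "y \<in> F q" if "y \<in> push i j (F q)" "wt (B q) y = rv rk (B q)" for y
    using push_F_wt[OF assms that(1)] that(2) by auto
  then have "push i j (F q) \<inter> {y. wt (B q) y = rv rk (B q)} = F q"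
    using subset_push[of "F q" i j] by (auto simp: tight_face_def)
  ultimately show ?thesis by (simp flip: wt_conv_inner)
qed

lemma F_neq_push_F:
  assumes "q \<in> {1..k}" shows "F q \<noteq> push i j (F q)"
proof
  assume eq: "F q = push i j (F q)"
  obtain y where y: "y \<in> F q"
    using megamatroid_polyhedron_nonempty[OF megamatroid_polyhedron_F[OF assms]] by blast
  then have "y + 1 *\<^sub>R dir i j \<in> F q" using pushI[OF y, of 1 i j] eq by simp
  then show False using y B[OF assms] by (simp add: tight_face_def wt_add wt_dir)
qed

text \<open>The difference of \<open>wt (B q)\<close> and \<open>wt (B p)\<close> is constant along
  \<open>dir i j\<close>, and on \<open>F p\<close> it is maximal exactly at the points of
  \<open>F q\<close>, so it supports the common part as a face. If that face were the whole piece,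
  \<open>F p\<close> would lie in \<open>F q\<close>, against \<open>antichain\<close>.\<close>

lemma push_F_meet:
  assumes p: "p \<in> {1..k}" and q: "q \<in> {1..k}" and pq: "p \<noteq> q"
  shows "push i j (F p) \<inter> push i j (F q) face_of push i j (F p) \<and>
    push i j (F p) \<inter> push i j (F q) \<noteq> push i j (F p)"
proof
  have Int: "push i j (F p) \<inter> push i j (F q) = push i j (F p \<inter> F q)"
    using push_tight_faces_Inter[of "{p, q}"] p q by simp
  define a :: "real ^ 'n" where "a = (\<chi> l. of_bool (l \<in> B q)) - (\<chi> l. of_bool (l \<in> B p))"
  have a: "a \<bullet> y = wt (B q) y - wt (B p) y" for y
    by (simp add: a_def inner_diff_left wt_conv_inner)
  have a_shift: "a \<bullet> (y - t *\<^sub>R dir i j) = a \<bullet> y" for y t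
    using B[OF p] B[OF q] by (simp add: a wt_diff wt_scaleR wt_dir)
  have aF: "a \<bullet> y \<le> rv rk (B q) - rv rk (B p)" if "y \<in> F p" for y
    using that B[OF q] by (simp add: a tight_face_def in_base_polyhedron_iff[OF mega])
  have "push i j (F p) \<inter> {y. a \<bullet> y = rv rk (B q) - rv rk (B p)} face_of push i j (F p)"
  proof (rule face_of_Int_supporting_hyperplane_le[OF convex_push_F[OF p]])
    fix y assume "y \<in> push i j (F p)"
    then obtain t where "y - t *\<^sub>R dir i j \<in> F p" using push_F_wt[OF p] by blast
    then show "a \<bullet> y \<le> rv rk (B q) - rv rk (B p)"
      using aF[of "y - t *\<^sub>R dir i j"] by (simp add: a_shift)
  qed
  moreover have "push i j (F p) \<inter> {y. a \<bullet> y = rv rk (B q) - rv rk (B p)} = push i j (F p \<inter> F q)"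
  proof -
    have "y \<in> F q \<longleftrightarrow> a \<bullet> y = rv rk (B q) - rv rk (B p)" if "y \<in> F p" for y
      using that by (auto simp: a tight_face_def)
    then show ?thesis unfolding push_def using a_shift by auto
  qed
  ultimately show "push i j (F p) \<inter> push i j (F q) face_of push i j (F p)"
    by (simp add: Int)
  show "push i j (F p) \<inter> push i j (F q) \<noteq> push i j (F p)"
  proof
    assume "push i j (F p) \<inter> push i j (F q) = push i j (F p)"
    then have "F p \<subseteq> base_polyhedron rk \<inter> push i j (F q)"
      using subset_push[of "F p" i j] tight_face_subset by blast
    then show False
      using base_polyhedron_Int_push[OF q] antichain[OF p q] pq by simp
  qed
qed

text \<open>The base polyhedron takes the last index, so that the index sets split into pairs
  \<open>I\<close> and \<open>insert (Suc k) I\<close> with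
  \<open>I \<subseteq> {1..k}\<close>.\<close>

definition piece :: "nat \<Rightarrow> (real ^ 'n) set" where
  "piece q = (if q = Suc k then base_polyhedron rk else push i j (F q))"

lemma piece_simps: "piece (Suc k) = base_polyhedron rk" "q \<in> {1..k} \<Longrightarrow> piece q = push i j (F q)"
  by (auto simp: piece_def)

lemma atLeast_Suc: "{1..Suc k} = insert (Suc k) {1..k}"
  by auto

text \<open>The base polyhedron meets the piece over \<open>F q\<close> in \<open>F q\<close>; the
  assumption makes this a proper face of the base polyhedron.\<close>

lemma push_decomposition:
  assumes "\<And>q. q \<in> {1..k} \<Longrightarrow> F q \<noteq> base_polyhedron rk"
  shows "megamatroid_decomposition (push i j (base_polyhedron rk)) (Suc k) piece"
  unfolding megamatroid_decomposition_def
proof (intro conjI ballI impI)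
  show "megamatroid_polyhedron (push i j (base_polyhedron rk))"
    using mega megamatroid_polyhedron_push unfolding megamatroid_polyhedron_def by blast
  show "megamatroid_polyhedron (piece q)" if "q \<in> {1..Suc k}" for q
    using that mega megamatroid_polyhedron_push[OF megamatroid_polyhedron_F]
    unfolding atLeast_Suc by (auto simp: piece_simps) (auto simp: megamatroid_polyhedron_def)
  show "push i j (base_polyhedron rk) = (\<Union>q\<in>{1..Suc k}. piece q)"
    unfolding push_eq_Union atLeast_Suc by (simp add: piece_simps)
  have base: "\<exists>G. G face_of base_polyhedron rk \<and> G \<noteq> base_polyhedron rk \<and> base_polyhedron rk \<inter> push i j (F q) \<subseteq> G"
    "\<exists>G. G face_of push i j (F q) \<and> G \<noteq> push i j (F q) \<and> base_polyhedron rk \<inter> push i j (F q) \<subseteq> G"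
    if "q \<in> {1..k}" for q
    using face_of_base_polyhedron[OF that] assms[OF that] face_of_push_F[OF that] F_neq_push_F[OF that]
    unfolding base_polyhedron_Int_push[OF that] by blast+
  have F: "\<exists>G. G face_of push i j (F p) \<and> G \<noteq> push i j (F p) \<and> push i j (F p) \<inter> push i j (F q) \<subseteq> G"
    if "p \<in> {1..k}" "q \<in> {1..k}" "p \<noteq> q" for p q
    using push_F_meet[OF that] by blast
  fix p q assume "p \<in> {1..Suc k}" "q \<in> {1..Suc k}" "p \<noteq> q"
  then consider "p = Suc k" "q \<in> {1..k}" | "q = Suc k" "p \<in> {1..k}" | "p \<in> {1..k}" "q \<in> {1..k}"
    unfolding atLeast_Suc by blast
  then have "(\<exists>G. G face_of piece p \<and> G \<noteq> piece p \<and> piece p \<inter> piece q \<subseteq> G) \<and>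
      (\<exists>G. G face_of piece q \<and> G \<noteq> piece q \<and> piece p \<inter> piece q \<subseteq> G)"
  proof cases
    case 1
    then show ?thesis using base[of q] by (simp add: piece_simps)
  next
    case 2
    then show ?thesis using base[of p] by (simp add: piece_simps Int_commute)
  next
    case 3
    then show ?thesis using F[of p q] F[of q p] \<open>p \<noteq> q\<close> by (simp add: piece_simps Int_commute)
  qed
  then show "piece p \<inter> piece q = {} \<or>
      (\<exists>G. G face_of piece p \<and> G \<noteq> piece p \<and> piece p \<inter> piece q \<subseteq> G) \<and>
      (\<exists>G. G face_of piece q \<and> G \<noteq> piece q \<and> piece p \<inter> piece q \<subseteq> G)" by blast
qed

text \<open>Ray sums commute with intersections of exit faces, and intersecting with the base
  polyhedron undoes the ray sum.\<close>

lemma cell_push: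
  assumes "I \<subseteq> {1..k}"
  shows "cell (push i j (base_polyhedron rk)) piece I =
      push i j (if I = {} then base_polyhedron rk else \<Inter>q\<in>I. F q)"
    and "cell (push i j (base_polyhedron rk)) piece (insert (Suc k) I) =
      (if I = {} then base_polyhedron rk else \<Inter>q\<in>I. F q)"
proof -
  have pieces: "(\<Inter>q\<in>I. piece q) = push i j (\<Inter>q\<in>I. F q)" if "I \<noteq> {}"
    unfolding push_tight_faces_Inter[OF assms that, symmetric] using assms by (auto simp: piece_simps subset_iff)
  then show "cell (push i j (base_polyhedron rk)) piece I =
      push i j (if I = {} then base_polyhedron rk else \<Inter>q\<in>I. F q)"
    by (simp add: cell_def)
  show "cell (push i j (base_polyhedron rk)) piece (insert (Suc k) I) =
      (if I = {} then base_polyhedron rk else \<Inter>q\<in>I. F q)"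
  proof (cases "I = {}")
    case False
    have "base_polyhedron rk \<inter> push i j (\<Inter>q\<in>I. F q) = (\<Inter>q\<in>I. base_polyhedron rk \<inter> push i j (F q))"
      using push_tight_faces_Inter[OF assms False] False by auto
    also have "\<dots> = (\<Inter>q\<in>I. F q)"
      using assms by (intro INF_cong refl base_polyhedron_Int_push) auto
    finally show ?thesis using False pieces by (simp add: cell_def piece_simps)
  qed (simp add: cell_def piece_simps)
qed

lemma cells_megamatroidal_push:
  "cells_megamatroidal (push i j (base_polyhedron rk)) (Suc k) piece"
proof -
  have Fs: "megamatroid_polyhedron (if I = {} then base_polyhedron rk else \<Inter>q\<in>I. F q)"
    if "I \<subseteq> {1..k}" "(if I = {} then base_polyhedron rk else \<Inter>q\<in>I. F q) \<noteq> {}" for I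
  proof (cases "I = {}")
    case True
    then show ?thesis using mega by (auto simp: megamatroid_polyhedron_def)
  next
    case False
    have "finite I" using that(1) finite_subset by blast
    moreover have "B ` I \<subseteq> finite_ranks rk" using that(1) B by blast
    ultimately show ?thesis
      using megamatroid_polyhedron_tight_faces[OF mega, of I B] False that(2) by simp
  qed
  have "megamatroid_polyhedron (cell (push i j (base_polyhedron rk)) piece I)"
    if I: "I \<subseteq> {1..Suc k}" and ne: "cell (push i j (base_polyhedron rk)) piece I \<noteq> {}" for I
  proof (cases "Suc k \<in> I")
    case True
    then obtain J where J: "I = insert (Suc k) J" "Suc k \<notin> J" by (meson Set.set_insert)
    then have "J \<subseteq> {1..k}" using I unfolding atLeast_Suc by auto
    then show ?thesis using Fs[of J] ne cell_push(2)[of J] J by simp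
  next
    case False
    then have sub: "I \<subseteq> {1..k}" using I unfolding atLeast_Suc by auto
    have "(if I = {} then base_polyhedron rk else \<Inter>q\<in>I. F q) \<noteq> {}"
      using ne push_empty unfolding cell_push(1)[OF sub] by force
    then show ?thesis
      unfolding cell_push(1)[OF sub] by (rule megamatroid_polyhedron_push[OF Fs[OF sub]])
  qed
  then show ?thesis unfolding cells_megamatroidal_def by blast
qed

text \<open>The part of \<open>m_val\<close> that depends only on the exit faces, and so is shared
  by all polyhedra having the same ones.\<close>

definition exit_sum :: "('n set \<Rightarrow> ereal) \<Rightarrow>\<^sub>0 int" where
  "exit_sum = (\<Sum>I\<in>Pow {1..k} - {{}}. frag_cmul ((-1) ^ card I)
     (cell_symbol (push i j (\<Inter>q\<in>I. F q)) - cell_symbol (\<Inter>q\<in>I. F q)))"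

text \<open>The terms of \<open>I\<close> and \<open>insert (Suc k) I\<close> have opposite signs
  and are combined; the pair with \<open>I = {}\<close> yields the two leading symbols.\<close>

lemma m_val_push:
  "m_val (push i j (base_polyhedron rk)) (Suc k) piece =
     frag_of (link i j rk) - frag_of rk + exit_sum"
proof -
  let ?c = "\<lambda>I. cell (push i j (base_polyhedron rk)) piece I"
  let ?t = "\<lambda>I. frag_cmul ((-1) ^ card I) (cell_symbol (?c I))"
  let ?G = "\<lambda>I. if I = {} then base_polyhedron rk else \<Inter>q\<in>I. F q"
  have inj: "inj_on (insert (Suc k)) (Pow {1..k})"
    by (rule inj_onI) (metis PowD Suc_n_not_le_n atLeastAtMost_iff insert_ident subsetD)
  have "m_val (push i j (base_polyhedron rk)) (Suc k) piece = sum ?t (Pow {1..k} \<union> insert (Suc k) ` Pow {1..k})"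
    unfolding m_val_cell_symbol atLeast_Suc Pow_insert ..
  also have "\<dots> = sum ?t (Pow {1..k}) + sum ?t (insert (Suc k) ` Pow {1..k})"
    by (rule sum.union_disjoint) auto
  also have "sum ?t (insert (Suc k) ` Pow {1..k}) = (\<Sum>I\<in>Pow {1..k}. ?t (insert (Suc k) I))"
    by (rule sum.reindex[OF inj, unfolded comp_def])
  also have "sum ?t (Pow {1..k}) + \<dots> = (\<Sum>I\<in>Pow {1..k}. ?t I + ?t (insert (Suc k) I))"
    by (simp add: sum.distrib)
  also have "\<dots> = (\<Sum>I\<in>Pow {1..k}. frag_cmul ((-1) ^ card I) (cell_symbol (push i j (?G I)) - cell_symbol (?G I)))"
  proof (rule sum.cong[OF refl])
    fix I assume "I \<in> Pow {1..k}"
    then have I: "I \<subseteq> {1..k}" "finite I" "Suc k \<notin> I" by (auto intro: finite_subset)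
    show "?t I + ?t (insert (Suc k) I) =
        frag_cmul ((-1) ^ card I) (cell_symbol (push i j (?G I)) - cell_symbol (?G I))"
      unfolding cell_push[OF I(1)] using I(2,3)
      by (simp add: frag_cmul_diff)
  qed
  also have "\<dots> = (cell_symbol (push i j (base_polyhedron rk)) - cell_symbol (base_polyhedron rk)) +
      (\<Sum>I\<in>Pow {1..k} - {{}}. frag_cmul ((-1) ^ card I) (cell_symbol (push i j (?G I)) - cell_symbol (?G I)))"
    by (subst sum.remove[of _ "{}"]) auto
  also have "(\<Sum>I\<in>Pow {1..k} - {{}}. frag_cmul ((-1) ^ card I) (cell_symbol (push i j (?G I)) - cell_symbol (?G I))) = exit_sum"
    unfolding exit_sum_def by (rule sum.cong) auto
  finally show ?thesis
    using base_polyhedron_link[OF mega, of i j] cell_symbol_base_polyhedron[OF mega]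
      cell_symbol_base_polyhedron[OF megamatroid_link[OF mega], of i j] by simp
qed

lemma m_val_push_in_relations:
  assumes "rk \<in> megamatroids r" "\<And>q. q \<in> {1..k} \<Longrightarrow> F q \<noteq> base_polyhedron rk"
  shows "frag_of (link i j rk) - frag_of rk + exit_sum \<in> decomposition_relations r"
proof -
  have "base_polyhedron (link i j rk) \<subseteq> {y. (\<Sum>i\<in>UNIV. y $ i) = of_int r}"
    using link_in_megamatroids[OF assms(1), of i j]
    by (auto simp: base_polyhedron_def megamatroids_def)
  then have "push i j (base_polyhedron rk) \<subseteq> {y. (\<Sum>i\<in>UNIV. y $ i) = of_int r}"
    by (simp add: base_polyhedron_link[OF mega])
  then show ?thesis
    unfolding decomposition_relations_def m_val_push[symmetric]
    using push_decomposition[OF assms(2)] cells_megamatroidal_push by blast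
qed

end

text \<open>The inclusion-maximal ones among the tight faces of sets containing \<open>i\<close> but
  not \<open>j\<close>. Faces rather than sets are enumerated, because different sets may have the
  same tight face.\<close>

lemma exists_exit_faces:
  assumes "megamatroid rk"
  shows "\<exists>k B. exit_faces rk i j k B"
proof -
  define \<A> where "\<A> = {A \<in> finite_ranks rk. i \<in> A \<and> j \<notin> A}"
  define M where "M = {G \<in> tight_face rk ` \<A>. \<forall>H \<in> tight_face rk ` \<A>. G \<subseteq> H \<longrightarrow> G = H}"
  have "finite M" by (simp add: M_def)
  then obtain h where h: "bij_betw h {1..card M} M" using ex_bij_betw_nat_finite_1 by blast
  have "\<forall>q\<in>{1..card M}. \<exists>A\<in>\<A>. tight_face rk A = h q"
    using bij_betwE[OF h] by (fastforce simp: M_def)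
  then obtain B where B: "\<And>q. q \<in> {1..card M} \<Longrightarrow> B q \<in> \<A> \<and> tight_face rk (B q) = h q" by metis
  have "exit_faces rk i j (card M) B"
  proof
    show "megamatroid rk" by fact
    show "B q \<in> finite_ranks rk \<and> i \<in> B q \<and> j \<notin> B q" if "q \<in> {1..card M}" for q
      using B[OF that] by (simp add: \<A>_def)
    show "\<exists>q\<in>{1..card M}. tight_face rk A \<subseteq> tight_face rk (B q)"
      if "A \<in> finite_ranks rk" "i \<in> A" "j \<notin> A" for A
    proof -
      have "tight_face rk A \<in> tight_face rk ` \<A>" using that by (auto simp: \<A>_def)
      moreover have "finite (tight_face rk ` \<A>)" by simp
      ultimately obtain G where "G \<in> tight_face rk ` \<A>" "tight_face rk A \<subseteq> G"
        "\<forall>H \<in> tight_face rk ` \<A>. G \<subseteq> H \<longrightarrow> G = H"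
        using finite_has_maximal2 by (metis (no_types, lifting))
      then have "G \<in> M" by (simp add: M_def)
      then have "G \<in> h ` {1..card M}" using h by (simp add: bij_betw_def)
      then obtain q where "q \<in> {1..card M}" "h q = G" by blast
      then show ?thesis using B \<open>tight_face rk A \<subseteq> G\<close> by metis
    qed
    show "p = q" if "p \<in> {1..card M}" "q \<in> {1..card M}" "tight_face rk (B p) \<subseteq> tight_face rk (B q)" for p q
    proof -
      have "h p \<subseteq> h q" "h p \<in> M" "h q \<in> M" using that B bij_betwE[OF h] by auto
      then have "h p = h q" unfolding M_def by blast
      then show ?thesis using inj_onD[OF bij_betw_imp_inj_on[OF h]] that by blast
    qed
  qed
  then show ?thesis by blast
qed

text \<open>Moving in direction \<open>dir j i\<close> lowers the weight of \<open>A\<close>, so on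
  the backward extension \<open>A\<close> is tight only at ray length 0.\<close>

lemma tight_face_link:
  assumes "megamatroid rk" "A \<in> finite_ranks rk" "i \<in> A" "j \<notin> A"
  shows "tight_face (link j i rk) A = tight_face rk A"
proof
  have rv: "rv (link j i rk) A = rv rk A" using assms by (simp add: rv_link)
  show "tight_face rk A \<subseteq> tight_face (link j i rk) A"
    using subset_push by (fastforce simp: tight_face_def rv base_polyhedron_link[OF assms(1)])
  show "tight_face (link j i rk) A \<subseteq> tight_face rk A"
  proof
    fix y assume y: "y \<in> tight_face (link j i rk) A"
    then obtain t where t: "t \<ge> 0" "y - t *\<^sub>R dir j i \<in> base_polyhedron rk"
      by (auto simp: tight_face_def base_polyhedron_link_iff[OF assms(1)])
    have "wt A y = rv rk A" using y by (simp add: tight_face_def rv)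
    moreover have "wt A y + t \<le> rv rk A"
      using t(2) assms by (auto simp: in_base_polyhedron_iff[OF assms(1)] wt_diff wt_scaleR wt_dir dest: bspec[of _ _ A])
    ultimately have "t = 0" using t(1) by simp
    then show "y \<in> tight_face rk A" using t(2) \<open>wt A y = rv rk A\<close> by (simp add: tight_face_def)
  qed
qed

text \<open>
  Pushing \<open>P\<close> and pushing \<open>P\<close> extended backwards add the same pieces, so that the
  difference of the two decomposition relations does not involve the exit faces.
\<close>

lemma link_relation:
  assumes "rk \<in> megamatroids r"
  shows "\<exists>m\<in>decomposition_relations r. \<exists>m'\<in>insert 0 (decomposition_relations r).
    frag_of rk + frag_of (link i j (link j i rk)) - frag_of (link i j rk) - frag_of (link j i rk) = m - m'"
proof -
  have mega: "megamatroid rk" using assms by (simp add: megamatroids_def)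
  obtain k B where "exit_faces rk i j k B" using exists_exit_faces[OF mega] by blast
  then interpret E: exit_faces rk i j k B .
  have face: "tight_face (link j i rk) (B q) = tight_face rk (B q)" if "q \<in> {1..k}" for q
    using tight_face_link[OF mega] E.B[OF that] by blast
  interpret E': exit_faces "link j i rk" i j k B
  proof
    show "megamatroid (link j i rk)" by (rule megamatroid_link[OF mega])
    show "B q \<in> finite_ranks (link j i rk) \<and> i \<in> B q \<and> j \<notin> B q" if "q \<in> {1..k}" for q
      using E.B[OF that] by (simp add: finite_ranks_link)
    show "\<exists>q\<in>{1..k}. tight_face (link j i rk) A \<subseteq> tight_face (link j i rk) (B q)"
      if "A \<in> finite_ranks (link j i rk)" "i \<in> A" "j \<notin> A" for A
      using E.exit[of A] that face by (auto simp: finite_ranks_link tight_face_link[OF mega])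
    show "p = q" if "p \<in> {1..k}" "q \<in> {1..k}"
      "tight_face (link j i rk) (B p) \<subseteq> tight_face (link j i rk) (B q)" for p q
      using E.antichain that by (simp add: face)
  qed
  have sum_eq: "E'.exit_sum = E.exit_sum"
  proof -
    have "(\<Inter>q\<in>I. tight_face (link j i rk) (B q)) = (\<Inter>q\<in>I. tight_face rk (B q))" if "I \<in> Pow {1..k} - {{}}" for I
      using that by (intro INF_cong refl face) auto
    then show ?thesis unfolding E.exit_sum_def E'.exit_sum_def by (intro sum.cong) simp_all
  qed
  \<comment> \<open>The backward extension contains a ray in direction \<open>dir j i\<close>, along
    which the weight of \<open>B q\<close> is not constant.\<close>
  have proper: "tight_face (link j i rk) (B q) \<noteq> base_polyhedron (link j i rk)" if q: "q \<in> {1..k}" for q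
  proof
    assume eq: "tight_face (link j i rk) (B q) = base_polyhedron (link j i rk)"
    obtain y where "y \<in> base_polyhedron rk" using base_polyhedron_nonempty[OF mega] by blast
    then have "y \<in> base_polyhedron (link j i rk)" "y + 1 *\<^sub>R dir j i \<in> base_polyhedron (link j i rk)"
      unfolding base_polyhedron_link[OF mega] using subset_push pushI[of y _ 1] by auto
    then have "wt (B q) y = wt (B q) (y + 1 *\<^sub>R dir j i)"
      unfolding eq[symmetric] by (simp add: tight_face_def)
    then show False using E.B[OF q] by (simp add: wt_add wt_dir)
  qed
  let ?m = "frag_of (link i j (link j i rk)) - frag_of (link j i rk) + E.exit_sum"
  have m: "?m \<in> decomposition_relations r"
    using E'.m_val_push_in_relations[OF link_in_megamatroids[OF assms] proper] by (simp add: sum_eq)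
  show ?thesis
  proof (cases "\<exists>q\<in>{1..k}. tight_face rk (B q) = base_polyhedron rk")
    case False
    then have "frag_of (link i j rk) - frag_of rk + E.exit_sum \<in> decomposition_relations r"
      by (intro E.m_val_push_in_relations assms) blast
    then show ?thesis using m by (intro bexI[OF _ m] bexI[of _ "frag_of (link i j rk) - frag_of rk + E.exit_sum"]) auto
  next
    case True
    \<comment> \<open>If \<open>B q\<close> is tight on the whole polyhedron, the antichain
      condition leaves this as the only exit face. The exit sum is then explicit, and
      \<open>m' = 0\<close> serves.\<close>
    then obtain q where q: "q \<in> {1..k}" "tight_face rk (B q) = base_polyhedron rk" by blast
    have "p = q" if "p \<in> {1..k}" for p
      using E.antichain[OF that q(1)] q(2) tight_face_subset by blast
    then have "{1..k} = {q}" using q(1) by blast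
    then have "Pow {1..k} - {{}} = {{q}}" by auto
    then have "E.exit_sum = frag_of rk - frag_of (link i j rk)"
      unfolding E.exit_sum_def
      by (simp add: q(2) base_polyhedron_link[OF mega, symmetric] cell_symbol_base_polyhedron mega megamatroid_link)
    then show ?thesis using m by (intro bexI[OF _ m] bexI[of _ 0]) auto
  qed
qed

section \<open>The kernel of the indicator map\<close>

lemma Psi_MM_superset:
  assumes "finite S" "Poly_Mapping.keys c \<subseteq> S"
  shows "Psi_MM c y = (\<Sum>rk\<in>S. Poly_Mapping.lookup c rk * indicator (base_polyhedron rk) y)"
  unfolding Psi_MM_def using assms by (intro sum.mono_neutral_left) (auto simp: in_keys_iff)

lemma Psi_MM_0 [simp]: "Psi_MM 0 = (\<lambda>y. 0)"
  by (simp add: Psi_MM_def)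

lemma Psi_MM_frag_of [simp]: "Psi_MM (frag_of rk) = indicator (base_polyhedron rk)"
  by (simp add: Psi_MM_def fun_eq_iff)

lemma Psi_MM_add: "Psi_MM (b + c) = (\<lambda>y. Psi_MM b y + Psi_MM c y)"
proof
  fix y
  let ?S = "Poly_Mapping.keys b \<union> Poly_Mapping.keys c"
  have "Poly_Mapping.keys (b + c) \<subseteq> ?S" by (rule keys_add)
  then show "Psi_MM (b + c) y = Psi_MM b y + Psi_MM c y"
    by (simp add: Psi_MM_superset[of ?S] lookup_add distrib_right sum.distrib)
qed

lemma Psi_MM_frag_cmul: "Psi_MM (frag_cmul a c) = (\<lambda>y. a * Psi_MM c y)"
proof
  fix y
  have "Poly_Mapping.keys (frag_cmul a c) \<subseteq> Poly_Mapping.keys c" by (rule keys_cmul)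
  then show "Psi_MM (frag_cmul a c) y = a * Psi_MM c y"
    by (simp only: Psi_MM_superset[of "Poly_Mapping.keys c"] finite_keys order_refl
        lookup_frag_cmul sum_distrib_left mult.assoc)
qed

lemma Psi_MM_diff: "Psi_MM (b - c) = (\<lambda>y. Psi_MM b y - Psi_MM c y)"
  using Psi_MM_add[of b "- c"] Psi_MM_frag_cmul[of "-1" c] by simp

lemma Psi_MM_sum: "Psi_MM (\<Sum>x\<in>X. g x) = (\<lambda>y. \<Sum>x\<in>X. Psi_MM (g x) y)"
  by (induction X rule: infinite_finite_induct) (simp_all add: Psi_MM_add)

text \<open>
  For each \<open>x\<close>, the difference of the values at \<open>x\<close> and slightly to the left of \<open>x\<close>
  counts the intervals with left endpoint \<open>x\<close>.
\<close>

lemma sum_nonempty_intervals: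
  fixes K :: "'k \<Rightarrow> real set" and a :: "'k \<Rightarrow> int"
  assumes "finite S" and K: "\<And>k. k \<in> S \<Longrightarrow> closed (K k) \<and> convex (K k) \<and> bdd_below (K k)"
    and zero: "\<And>t. (\<Sum>k\<in>S. a k * indicator (K k) t) = 0"
  shows "(\<Sum>k\<in>{k \<in> S. K k \<noteq> {}}. a k) = 0"
proof -
  let ?S = "{k \<in> S. K k \<noteq> {}}"
  have Inf_in: "Inf (K k) \<in> K k" if "k \<in> ?S" for k
    using that K by (intro closed_contains_Inf) auto
  have left: "\<forall>\<^sub>F t in at_left x. indicator (K k) x - indicator (K k) t =
      (if K k \<noteq> {} \<and> Inf (K k) = x then 1 else 0 :: int)" if k: "k \<in> S" for k x
  proof (cases "x \<in> K k")
    case False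
    then have "\<forall>\<^sub>F t in at_left x. t \<in> - K k"
      using K[OF k] by (intro topological_tendstoD[OF tendsto_ident_at]) auto
    then show ?thesis
      using False Inf_in k by (elim eventually_mono) (auto simp: indicator_def)
  next
    case True
    have lt: "\<forall>\<^sub>F t in at_left x. t < x" by (simp add: eventually_at_filter)
    have le: "Inf (K k) \<le> t" if "t \<in> K k" for t using K[OF k] that by (intro cInf_lower) auto
    show ?thesis
    proof (cases "Inf (K k) = x")
      case eq: True
      show ?thesis
        using lt by (elim eventually_mono) (use True le eq in \<open>fastforce simp: indicator_def\<close>)
    next
      case False
      then have "Inf (K k) < x" using le[OF True] by simp
      then have "\<forall>\<^sub>F t in at_left x. Inf (K k) < t"
        by (intro order_tendstoD[OF tendsto_ident_at])
      with lt show ?thesis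
      proof eventually_elim
        case (elim t)
        have "is_interval (K k)" using K[OF k] by (simp add: is_interval_convex_1)
        moreover have "Inf (K k) \<in> K k" using Inf_in[of k] True k by blast
        ultimately have "t \<in> K k"
          using mem_is_interval_1_I[of "K k" "Inf (K k)" x t] True elim by simp
        then show ?case using True False by simp
      qed
    qed
  qed
  \<comment> \<open>As \<open>S\<close> is finite, a single \<open>t\<close> close to
    \<open>x\<close> serves all the intervals at once.\<close>
  have "(\<Sum>k\<in>{k \<in> ?S. Inf (K k) = x}. a k) = 0" for x
  proof -
    have "\<forall>\<^sub>F t in at_left x. \<forall>k\<in>S. indicator (K k) x - indicator (K k) t =
      (if K k \<noteq> {} \<and> Inf (K k) = x then 1 else 0 :: int)"
      using \<open>finite S\<close> left by (intro eventually_ball_finite) auto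
    then obtain t where t: "\<And>k. k \<in> S \<Longrightarrow> indicator (K k) x - indicator (K k) t =
      (if K k \<noteq> {} \<and> Inf (K k) = x then 1 else 0 :: int)"
      using eventually_happens'[OF trivial_limit_at_left_real] by blast
    have "(\<Sum>k\<in>{k \<in> ?S. Inf (K k) = x}. a k) = (\<Sum>k\<in>S. a k * (if K k \<noteq> {} \<and> Inf (K k) = x then 1 else 0))"
      using \<open>finite S\<close> by (intro sum.mono_neutral_cong_left) auto
    also have "\<dots> = (\<Sum>k\<in>S. a k * indicator (K k) x - a k * indicator (K k) t)"
      by (intro sum.cong refl) (simp add: t[symmetric] right_diff_distrib)
    also have "\<dots> = 0" by (simp add: sum_subtractf zero)
    finally show ?thesis .
  qed
  moreover have "(\<Sum>k\<in>?S. a k) = (\<Sum>x\<in>(\<lambda>k. Inf (K k)) ` ?S. \<Sum>k\<in>{k \<in> ?S. Inf (K k) = x}. a k)"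
    using \<open>finite S\<close> by (intro sum.image_gen) auto
  ultimately show ?thesis by simp
qed

section \<open>Ray sums of elements of the kernel\<close>

definition link_map :: "'n \<Rightarrow> 'n \<Rightarrow> (('n set \<Rightarrow> ereal) \<Rightarrow>\<^sub>0 int) \<Rightarrow> (('n set \<Rightarrow> ereal) \<Rightarrow>\<^sub>0 int)" where
  "link_map i j = frag_extend (\<lambda>rk. frag_of (link i j rk))"

lemma keys_link_map: "Poly_Mapping.keys (link_map i j c) \<subseteq> link i j ` Poly_Mapping.keys c"
  using keys_frag_extend[of "\<lambda>rk. frag_of (link i j rk)" c] by (auto simp: link_map_def)

text \<open>A point \<open>y\<close> lies in the ray sum iff the backward ray from \<open>y\<close>
  meets the polyhedron, in a closed interval of lengths bounded below by 0. Hence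
  \<open>sum_nonempty_intervals\<close> applies to the restriction to this ray.\<close>

lemma Psi_MM_link_map_eq_0:
  assumes c: "Poly_Mapping.keys c \<subseteq> Collect megamatroid" and zero: "Psi_MM c = (\<lambda>y. 0)"
  shows "Psi_MM (link_map i j c) = (\<lambda>y. 0)"
proof
  fix y
  let ?S = "Poly_Mapping.keys c" and ?a = "Poly_Mapping.lookup c"
  define K where "K rk = {t. 0 \<le> t \<and> y - t *\<^sub>R dir i j \<in> base_polyhedron rk}" for rk
  have K: "closed (K rk) \<and> convex (K rk) \<and> bdd_below (K rk)" if "rk \<in> ?S" for rk
  proof (intro conjI)
    have mega: "megamatroid rk" using c that by blast
    have K_eq: "K rk = {0..} \<inter> (\<lambda>t. y - t *\<^sub>R dir i j) -` base_polyhedron rk" by (auto simp: K_def)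
    have "closed ((\<lambda>t. y - t *\<^sub>R dir i j) -` base_polyhedron rk)"
      by (intro continuous_closed_vimage closed_base_polyhedron mega continuous_intros)
    then show "closed (K rk)" unfolding K_eq by (intro closed_Int) auto
    show "convex (K rk)"
    proof (rule convexI)
      fix s t u v :: real
      assume st: "s \<in> K rk" "t \<in> K rk" and uv: "0 \<le> u" "0 \<le> v" "u + v = 1"
      have "u *\<^sub>R (y - s *\<^sub>R dir i j) + v *\<^sub>R (y - t *\<^sub>R dir i j) \<in> base_polyhedron rk"
        using st uv by (intro convexD[OF convex_base_polyhedron[OF mega]]) (auto simp: K_def)
      moreover have "u *\<^sub>R (y - s *\<^sub>R dir i j) + v *\<^sub>R (y - t *\<^sub>R dir i j) =
          (u + v) *\<^sub>R y - (u *\<^sub>R s + v *\<^sub>R t) *\<^sub>R dir i j"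
        by (simp add: algebra_simps)
      ultimately show "u *\<^sub>R s + v *\<^sub>R t \<in> K rk"
        using st uv by (simp add: K_def)
    qed
    show "bdd_below (K rk)" by (rule bdd_belowI[of _ 0]) (simp add: K_def)
  qed
  have "(\<Sum>rk\<in>?S. ?a rk * indicator (K rk) t) = 0" for t
  proof (cases "0 \<le> t")
    case True
    then have "indicator (K rk) t = (indicator (base_polyhedron rk) (y - t *\<^sub>R dir i j) :: int)" for rk
      by (simp add: K_def indicator_def)
    then show ?thesis using fun_cong[OF zero, of "y - t *\<^sub>R dir i j"] by (simp add: Psi_MM_def)
  qed (simp add: K_def)
  then have "(\<Sum>rk\<in>{rk \<in> ?S. K rk \<noteq> {}}. ?a rk) = 0"
    using K by (intro sum_nonempty_intervals) auto
  moreover have "Psi_MM (link_map i j c) y = (\<Sum>rk\<in>?S. ?a rk * indicator (base_polyhedron (link i j rk)) y)"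
    by (simp add: link_map_def frag_extend_def Psi_MM_sum Psi_MM_frag_cmul)
  moreover have "\<dots> = (\<Sum>rk\<in>{rk \<in> ?S. K rk \<noteq> {}}. ?a rk)"
  proof (rule sum.mono_neutral_cong_right)
    have "y \<in> base_polyhedron (link i j rk) \<longleftrightarrow> K rk \<noteq> {}" if "rk \<in> ?S" for rk
      using base_polyhedron_link_iff[of rk y i j] c that by (auto simp: K_def)
    then show "\<forall>rk\<in>?S - {rk \<in> ?S. K rk \<noteq> {}}. ?a rk * indicator (base_polyhedron (link i j rk)) y = 0"
      "\<And>rk. rk \<in> {rk \<in> ?S. K rk \<noteq> {}} \<Longrightarrow> ?a rk * indicator (base_polyhedron (link i j rk)) y = ?a rk"
      by auto
  qed auto
  ultimately show "Psi_MM (link_map i j c) y = 0" by simp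
qed

text \<open>Evaluating at a point where the constraints of a maximal key are tight isolates that key.\<close>

lemma Psi_MM_chain_inject:
  assumes c: "Poly_Mapping.keys c \<subseteq> megamatroids r"
    and chain: "open_pairs (\<Union>rk\<in>Poly_Mapping.keys c. finite_ranks rk) = {}"
    and zero: "Psi_MM c = (\<lambda>y. 0)"
  shows "c = 0"
proof (rule ccontr)
  let ?S = "Poly_Mapping.keys c"
  assume "c \<noteq> 0"
  then have "?S \<noteq> {}" by simp
  then obtain rk where rk: "rk \<in> ?S" "\<And>rk'. rk' \<in> ?S \<Longrightarrow> rk \<le> rk' \<Longrightarrow> rk = rk'"
    using finite_has_maximal[of ?S] by auto
  have mega: "megamatroid rk'" and top: "rv rk' UNIV = of_int r" if "rk' \<in> ?S" for rk'
    using c that by (auto simp: megamatroids_def rv_def)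
  \<comment> \<open>\<open>N\<close> exceeds all finite ranks that occur. As the prescribed weight
    of a set of infinite rank under \<open>rk\<close>, it excludes every key that gives this set a
    finite rank.\<close>
  define N where "N = 1 + Max ((\<lambda>(rk, A). rv rk A) ` (?S \<times> UNIV))"
  have N: "rv rk' A < N" if "rk' \<in> ?S" for rk' A
  proof -
    have "rv rk' A \<le> Max ((\<lambda>(rk, A). rv rk A) ` (?S \<times> UNIV))"
      by (rule Max_ge) (use that in auto)
    then show ?thesis by (simp add: N_def)
  qed
  define v where "v A = (if A \<in> finite_ranks rk then rv rk A else N)" for A
  obtain y where y: "\<And>A rk'. rk' \<in> ?S \<Longrightarrow> A \<in> finite_ranks rk' \<Longrightarrow> wt A y = v A"
  proof -
    have "v {} = 0"
      using mega[OF rk(1)] by (simp add: v_def megamatroid_empty_finite megamatroid_rv_empty)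
    then have "\<exists>y. \<forall>A\<in>\<Union>rk\<in>?S. finite_ranks rk. wt A y = v A"
      by (intro exists_wt_chain open_pairs_empty_chain[OF chain])
    then show thesis using that by blast
  qed
  have "y \<in> base_polyhedron rk' \<longleftrightarrow> rk' = rk" if rk': "rk' \<in> ?S" for rk'
  proof
    assume "rk' = rk"
    then show "y \<in> base_polyhedron rk'"
      using y[OF rk(1)] mega[OF rk(1)]
      by (simp add: in_base_polyhedron_iff v_def megamatroid_UNIV_finite)
  next
    assume "y \<in> base_polyhedron rk'"
    then have le: "v A \<le> rv rk' A" if "A \<in> finite_ranks rk'" for A
      using that y[OF rk' that] by (auto simp: in_base_polyhedron_iff[OF mega[OF rk']])
    have "rk A \<le> rk' A" for A
    proof (cases "A \<in> finite_ranks rk'")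
      case True
      then have "A \<in> finite_ranks rk" "rv rk A \<le> rv rk' A"
        using le[OF True] N[OF rk', of A] by (auto simp: v_def split: if_splits)
      then show ?thesis
        using True megamatroid_rv[OF mega[OF rk']] megamatroid_rv[OF mega[OF rk(1)]] by simp
    qed (simp add: finite_ranks_def)
    then show "rk' = rk" using rk(2)[OF rk'] by (simp add: le_fun_def)
  qed
  then have "Psi_MM c y = (\<Sum>rk'\<in>?S. if rk' = rk then Poly_Mapping.lookup c rk' else 0)"
    unfolding Psi_MM_def by (intro sum.cong) (auto simp: indicator_def)
  also have "\<dots> = Poly_Mapping.lookup c rk" using rk(1) by simp
  finally show False using zero rk(1) by (simp add: in_keys_iff)
qed

section \<open>Decomposition relations and the kernel\<close>

lemma megamatroid_of_mem:
  assumes "megamatroid_polyhedron X" "X \<subseteq> {y. (\<Sum>i\<in>UNIV. y $ i) = of_int r}"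
  shows "megamatroid_of X \<in> megamatroids r" "base_polyhedron (megamatroid_of X) = X"
proof -
  obtain rk where rk: "megamatroid rk" "base_polyhedron rk = X"
    using assms(1) by (auto simp: megamatroid_polyhedron_def)
  then have of: "megamatroid_of X = rk" using megamatroid_of_base_polyhedron by blast
  then show "base_polyhedron (megamatroid_of X) = X" using rk by simp
  obtain y where "y \<in> X" using rk base_polyhedron_nonempty by blast
  then have "rk UNIV = ereal (of_int r)"
    using assms(2) rk(2) by (auto simp: base_polyhedron_def)
  then show "megamatroid_of X \<in> megamatroids r" using rk of by (simp add: megamatroids_def)
qed

text \<open>Inclusion-exclusion: at a point of \<open>P\<close> the alternating sum is the product
  of \<open>1 - indicator (Q i) y\<close>, with a zero factor for any piece containing the
  point.\<close>

lemma decomposition_relations_kernel: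
  assumes "m \<in> decomposition_relations r"
  shows "Poly_Mapping.keys m \<subseteq> megamatroids r" "Psi_MM m = (\<lambda>y. 0)"
proof -
  obtain P k Q where m: "m = m_val P k Q" and dec: "megamatroid_decomposition P k Q"
    and cells: "cells_megamatroidal P k Q" and P: "P \<subseteq> {y. (\<Sum>i\<in>UNIV. y $ i) = of_int r}"
    using assms by (auto simp: decomposition_relations_def)
  have PQ: "P = (\<Union>i\<in>{1..k}. Q i)" using dec by (simp add: megamatroid_decomposition_def)
  have sub: "cell P Q I \<subseteq> P" if "I \<subseteq> {1..k}" for I
    using that unfolding cell_def PQ by auto
  have mem: "megamatroid_of (cell P Q I) \<in> megamatroids r"
    "base_polyhedron (megamatroid_of (cell P Q I)) = cell P Q I"
    if "I \<subseteq> {1..k}" "cell P Q I \<noteq> {}" for I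
    using megamatroid_of_mem[of "cell P Q I" r] cells that sub[OF that(1)] P
    by (auto simp: cells_megamatroidal_def)
  have "m \<in> carrier (free_Abelian_group (megamatroids r))"
    unfolding m m_val_def
  proof (rule sum_closed_free_Abelian_group)
    fix I assume "I \<in> Pow {1..k}"
    then have "Poly_Mapping.keys (if cell P Q I = {} then 0 else frag_of (megamatroid_of (cell P Q I))) \<subseteq> megamatroids r"
      using mem(1)[of I] by simp
    then show "frag_cmul ((-1) ^ card I) (if cell P Q I = {} then 0 else frag_of (megamatroid_of (cell P Q I)))
        \<in> carrier (free_Abelian_group (megamatroids r))"
      unfolding carrier_free_Abelian_group_iff by (rule order_trans[OF keys_cmul])
  qed
  then show "Poly_Mapping.keys m \<subseteq> megamatroids r" by simp
  show "Psi_MM m = (\<lambda>y. 0)"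
  proof
    fix y
    have "Psi_MM m y = (\<Sum>I\<in>Pow {1..k}. (-1) ^ card I * indicator (cell P Q I) y)"
      unfolding m m_val_def Psi_MM_sum Psi_MM_frag_cmul
      by (intro sum.cong refl) (auto simp: mem)
    also have "\<dots> = 0"
    proof (cases "y \<in> P")
      case False
      then have "y \<notin> cell P Q I" if "I \<in> Pow {1..k}" for I using sub that by blast
      then show ?thesis by (intro sum.neutral) simp
    next
      case True
      then obtain i where i: "i \<in> {1..k}" "y \<in> Q i" using PQ by blast
      have "indicator (cell P Q I) y = (\<Prod>i\<in>I. indicator (Q i) y :: int)" if "I \<in> Pow {1..k}" for I
      proof -
        have "finite I" using that finite_subset by blast
        then have "(\<Prod>i\<in>I. indicator (Q i) y :: int) = (if \<forall>i\<in>I. y \<in> Q i then 1 else 0)"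
          by (induction I) auto
        then show ?thesis using True by (auto simp: cell_def indicator_def)
      qed
      then have "(\<Sum>I\<in>Pow {1..k}. (-1) ^ card I * indicator (cell P Q I) y) =
          (\<Sum>I\<in>Pow {1..k}. (-1) ^ card I * (\<Prod>i\<in>I. indicator (Q i) y) * (\<Prod>i\<in>{1..k} - I. 1 :: int))"
        by (intro sum.cong refl) simp
      also have "\<dots> = (\<Prod>i\<in>{1..k}. 1 - indicator (Q i) y)"
        by (rule prod_diff_conv_sum[symmetric]) simp
      also have "\<dots> = 0" using i by (intro prod_zero) (auto intro!: bexI[of _ i])
      finally show ?thesis .
    qed
    finally show "Psi_MM m y = 0" .
  qed
qed

text \<open>Induction on the number of open pairs. Linking an open pair expresses \<open>c\<close>
  modulo \<open>H\<close> by linked elements, which stay in the kernel and have fewer open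
  pairs.\<close>

lemma kernel_Psi_MM_subset_subgroup:
  fixes r :: int and H :: "(('n::finite set \<Rightarrow> ereal) \<Rightarrow>\<^sub>0 int) set"
  assumes zero: "0 \<in> H" and diff: "\<And>a b. a \<in> H \<Longrightarrow> b \<in> H \<Longrightarrow> a - b \<in> H"
    and rel: "decomposition_relations r \<subseteq> H"
    and c: "Poly_Mapping.keys c \<subseteq> megamatroids r" "Psi_MM c = (\<lambda>y. 0)"
  shows "c \<in> H"
  using c
proof (induction "card (open_pairs (\<Union>rk\<in>Poly_Mapping.keys c. finite_ranks rk))"
    arbitrary: c rule: less_induct)
  case less
  let ?D = "\<lambda>c. \<Union>rk\<in>Poly_Mapping.keys c. finite_ranks rk"
  show ?case
  proof (cases "open_pairs (?D c) = {}")
    case True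
    then show ?thesis using Psi_MM_chain_inject[OF less.prems(1) True less.prems(2)] zero by simp
  next
    case False
    then obtain i j where ij: "(i, j) \<in> open_pairs (?D c)" by auto
    have mem: "Poly_Mapping.keys (link_map i j b) \<subseteq> megamatroids r \<and> Psi_MM (link_map i j b) = (\<lambda>y. 0)"
      if "Poly_Mapping.keys b \<subseteq> megamatroids r" "Psi_MM b = (\<lambda>y. 0)" for i j b
    proof
      show "Poly_Mapping.keys (link_map i j b) \<subseteq> megamatroids r"
        using keys_link_map[of i j b] that(1) link_in_megamatroids by blast
      show "Psi_MM (link_map i j b) = (\<lambda>y. 0)"
        using that by (intro Psi_MM_link_map_eq_0) (auto simp: megamatroids_def)
    qed
    have D: "?D (link_map i j b) \<subseteq> {A \<in> ?D b. i \<in> A \<longrightarrow> j \<in> A}" for i j b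
      using keys_link_map[of i j b] by (fastforce simp: finite_ranks_link)
    have 1: "link_map i j c \<in> H" "link_map j i c \<in> H"
      using mem[OF less.prems] D[of i j c] D[of j i c]
      by (auto intro!: less.hyps card_open_pairs_less[OF ij])
    have "?D (link_map i j (link_map j i c)) \<subseteq> {A \<in> ?D c. j \<in> A \<longrightarrow> i \<in> A}"
      using D[of i j "link_map j i c"] D[of j i c] by blast
    then have 2: "link_map i j (link_map j i c) \<in> H"
      using mem[OF less.prems, of j i] mem[of "link_map j i c" i j]
      by (auto intro!: less.hyps card_open_pairs_less[OF ij])
    \<comment> \<open>The expression is additive in \<open>c\<close>, so it suffices to treat the
      basis elements, where it is the content of \<open>link_relation\<close>.\<close>
    have combination: "c + link_map i j (link_map j i c) - link_map i j c - link_map j i c \<in> H"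
    proof (rule free_Abelian_group_induct[OF less.prems(1),
          where P = "\<lambda>c. c + link_map i j (link_map j i c) - link_map i j c - link_map j i c \<in> H"])
      show "0 + link_map i j (link_map j i 0) - link_map i j 0 - link_map j i 0 \<in> H"
        by (simp add: zero link_map_def)
    next
      fix a b
      assume "a + link_map i j (link_map j i a) - link_map i j a - link_map j i a \<in> H"
        "b + link_map i j (link_map j i b) - link_map i j b - link_map j i b \<in> H"
      from diff[OF this]
      show "a - b + link_map i j (link_map j i (a - b)) - link_map i j (a - b) - link_map j i (a - b) \<in> H"
        by (simp add: link_map_def frag_extend_diff algebra_simps)
    next
      fix rk :: "'n set \<Rightarrow> ereal" assume "rk \<in> megamatroids r"
      from link_relation[OF this, of i j] obtain m m' where "m \<in> H" "m' \<in> H"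
        "frag_of rk + frag_of (link i j (link j i rk)) - frag_of (link i j rk) - frag_of (link j i rk) = m - m'"
        using rel zero by blast
      then show "frag_of rk + link_map i j (link_map j i (frag_of rk)) - link_map i j (frag_of rk)
          - link_map j i (frag_of rk) \<in> H"
        using diff by (simp add: link_map_def)
    qed
    have add: "a + b \<in> H" if "a \<in> H" "b \<in> H" for a b
      using diff[OF that(1) diff[OF zero that(2)]] by simp
    show ?thesis
      using diff[OF add[OF add[OF combination 1(2)] 1(1)] 2] by (simp add: algebra_simps)
  qed
qed

section \<open>Factoring through \<open>P_MM\<close>\<close>

lemma group_int_functions: "group int_functions"
proof (rule groupI)
  show "\<exists>y\<in>carrier int_functions. y \<otimes>\<^bsub>int_functions\<^esub> x = \<one>\<^bsub>int_functions\<^esub>" for x :: "'b \<Rightarrow> int"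
    by (rule bexI[of _ "\<lambda>b. - x b"]) (auto simp: int_functions_def)
qed (auto simp: int_functions_def)

lemma inv_int_functions: "inv\<^bsub>int_functions\<^esub> h = (\<lambda>x. - h x)"
  by (rule group.inv_equality[OF group_int_functions]) (auto simp: int_functions_def)

lemma P_MM_subset_range:
  assumes "h \<in> carrier (P_MM r)"
  shows "\<exists>c. Poly_Mapping.keys c \<subseteq> megamatroids r \<and> Psi_MM c = h"
proof -
  have "h \<in> generate int_functions ((\<lambda>rk. indicator (base_polyhedron rk)) ` megamatroids r)"
    using assms by (simp add: P_MM_def)
  then show ?thesis
  proof induction
    case one
    show ?case by (rule exI[of _ 0]) (simp add: int_functions_def)
  next
    case (incl h)
    then obtain rk where "rk \<in> megamatroids r" "h = indicator (base_polyhedron rk)" by auto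
    then show ?case by (intro exI[of _ "frag_of rk"]) simp
  next
    case (inv h)
    then obtain rk where "rk \<in> megamatroids r" "h = indicator (base_polyhedron rk)" by auto
    then show ?case
      by (intro exI[of _ "0 - frag_of rk"]) (simp only: Psi_MM_diff, simp add: inv_int_functions)
  next
    case (eng h1 h2)
    then obtain c1 c2 where "Poly_Mapping.keys c1 \<subseteq> megamatroids r" "Psi_MM c1 = h1"
      "Poly_Mapping.keys c2 \<subseteq> megamatroids r" "Psi_MM c2 = h2" by blast
    then show ?case
      using keys_add[of c1 c2] by (intro exI[of _ "c1 + c2"]) (auto simp: Psi_MM_add int_functions_def)
  qed
qed

theorem theorem3p5:
  fixes A :: "('a, 'b) monoid_scheme"
    and r :: int
    and f :: "(('n::finite set \<Rightarrow> ereal) \<Rightarrow>\<^sub>0 int) \<Rightarrow> 'a"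
  assumes "comm_group A"
    and "f \<in> hom (Z_MM r) A"
  shows "weakly_valuative r A f \<longleftrightarrow> strongly_valuative r A f"
proof -
  interpret A: comm_group A by fact
  let ?M = "{c. Poly_Mapping.keys c \<subseteq> (megamatroids r :: ('n set \<Rightarrow> ereal) set)}"
  have Z: "carrier (Z_MM r) = ?M" by (auto simp: Z_MM_def)
  have closed: "f c \<in> carrier A" if "c \<in> ?M" for c
    using hom_in_carrier[OF assms(2)] that Z by blast
  have add: "f (a + b) = f a \<otimes>\<^bsub>A\<^esub> f b" if "a \<in> ?M" "b \<in> ?M" for a b
    using hom_mult[OF assms(2), of a b] that Z by (simp add: Z_MM_def)
  have sub: "a - b \<in> ?M" if "a \<in> ?M" "b \<in> ?M" for a b
    using that keys_diff[of a b] by auto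
  have f0: "f 0 = \<one>\<^bsub>A\<^esub>"
    using add[of 0 0] closed[of 0] by simp
  have eq_if: "f a = f b" if "a \<in> ?M" "b \<in> ?M" "f (a - b) = \<one>\<^bsub>A\<^esub>" for a b
    using add[OF sub[OF that(1,2)] that(2)] that closed by simp
  have diff: "f (a - b) = \<one>\<^bsub>A\<^esub>" if "a \<in> ?M" "b \<in> ?M" "f a = \<one>\<^bsub>A\<^esub>" "f b = \<one>\<^bsub>A\<^esub>" for a b
    using add[OF sub[OF that(1,2)] that(2)] that closed[OF sub[OF that(1,2)]] by simp
  have weak: "weakly_valuative r A f \<longleftrightarrow> (\<forall>m\<in>decomposition_relations r. f m = \<one>\<^bsub>A\<^esub>)"
    by (auto simp: weakly_valuative_def decomposition_relations_def)
  show ?thesis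
  proof
    assume "weakly_valuative r A f"
    \<comment> \<open>The kernel of \<open>f\<close> is the subgroup to which
      \<open>kernel_Psi_MM_subset_subgroup\<close> is applied.\<close>
    then have rel: "decomposition_relations r \<subseteq> {c \<in> ?M. f c = \<one>\<^bsub>A\<^esub>}"
      using decomposition_relations_kernel(1) weak by blast
    have ker: "f c = \<one>\<^bsub>A\<^esub>" if "c \<in> ?M" "Psi_MM c = (\<lambda>y. 0)" for c
    proof -
      have "c \<in> {c \<in> ?M. f c = \<one>\<^bsub>A\<^esub>}"
      proof (rule kernel_Psi_MM_subset_subgroup[OF _ _ rel])
        show "a - b \<in> {c \<in> ?M. f c = \<one>\<^bsub>A\<^esub>}"
          if "a \<in> {c \<in> ?M. f c = \<one>\<^bsub>A\<^esub>}" "b \<in> {c \<in> ?M. f c = \<one>\<^bsub>A\<^esub>}" for a b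
          using sub[of a b] diff[of a b] that by blast
      qed (use that f0 in auto)
      then show ?thesis by simp
    qed
    have wd: "f a = f b" if "a \<in> ?M" "b \<in> ?M" "Psi_MM a = Psi_MM b" for a b
      using that by (intro eq_if ker sub) (simp_all add: Psi_MM_diff)
    \<comment> \<open>A choice of preimages under \<open>Psi_MM\<close>; by \<open>wd\<close> the
      value of \<open>f\<close> does not depend on the choice, which makes \<open>f (s h)\<close>
      additive in \<open>h\<close>.\<close>
    define s where "s h = (SOME c. c \<in> ?M \<and> Psi_MM c = h)" for h
    have s: "s h \<in> ?M \<and> Psi_MM (s h) = h" if "h \<in> carrier (P_MM r)" for h
      unfolding s_def by (rule someI_ex) (use P_MM_subset_range[OF that] in auto)
    have sPsi: "f (s (Psi_MM c)) = f c" if "c \<in> ?M" for c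
    proof -
      have "s (Psi_MM c) \<in> ?M \<and> Psi_MM (s (Psi_MM c)) = Psi_MM c"
        unfolding s_def by (rule someI_ex) (use that in auto)
      then show ?thesis using that by (intro wd) auto
    qed
    have "(\<lambda>h. f (s h)) \<in> hom (P_MM r) A"
    proof (rule homI)
      show "f (s h) \<in> carrier A" if "h \<in> carrier (P_MM r)" for h
        using s[OF that] by (intro closed) simp
      show "f (s (g \<otimes>\<^bsub>P_MM r\<^esub> h)) = f (s g) \<otimes>\<^bsub>A\<^esub> f (s h)"
        if g: "g \<in> carrier (P_MM r)" and h: "h \<in> carrier (P_MM r)" for g h
      proof -
        have "s g + s h \<in> ?M" using s[OF g] s[OF h] keys_add[of "s g" "s h"] by auto
        moreover have "Psi_MM (s g + s h) = g \<otimes>\<^bsub>P_MM r\<^esub> h"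
          using s[OF g] s[OF h] by (simp add: Psi_MM_add P_MM_def int_functions_def)
        ultimately have "f (s (g \<otimes>\<^bsub>P_MM r\<^esub> h)) = f (s g + s h)" using sPsi by metis
        then show ?thesis using add s[OF g] s[OF h] by simp
      qed
    qed
    then show "strongly_valuative r A f"
      unfolding strongly_valuative_def Z using sPsi by (intro bexI[of _ "\<lambda>h. f (s h)"]) auto
  next
    assume "strongly_valuative r A f"
    then obtain g where g: "\<And>c. c \<in> ?M \<Longrightarrow> f c = g (Psi_MM c)"
      unfolding strongly_valuative_def Z by blast
    \<comment> \<open>Both \<open>m\<close> and 0 have image 0 under \<open>Psi_MM\<close>, so
      \<open>f\<close> takes the same value on them.\<close>
    have "f m = \<one>\<^bsub>A\<^esub>" if "m \<in> decomposition_relations r" for m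
      using decomposition_relations_kernel[OF that] g[of m] g[of 0] f0 by simp
    then show "weakly_valuative r A f" using weak by blast
  qed
qed

end
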